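(* Let $\phi: S_n\rightarrow S_n$ be a map and let $\alpha$ satisfy $\alpha^n=\det \phi(I)$. Then the following statements are equivalent. (1) There exists an invertible matrix $P\in M_n$ with $(\det P)^2=1$ such that $\phi(A)=\alpha PAP^{t}$ for all $A\in S_n$. (2) $\phi$ sends invertible matrices in $S_n$ into invertible matrices in $S_n$, and $\operatorname{tr}(\phi(A)\phi(B)^{-1})=\operatorname{tr}(AB^{-1})$ for all $A\in S_n$ and all invertible matrices $B\in S_n$. (3) $\det(t\phi(A)+(1-t)\phi(B))=\alpha^n\det(tA+(1-t)B)$ for all $A,B\in S_n$ and all $t\in[0,1]$. (4) $\phi$ is surjective and there exist two specific $t\in[0,1]$ such that $\det(t\phi(A)+(1-t)\phi(B))=\alpha^n\det(tA+(1-t)B)$ for all $A,B\in S_n$.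
   Context: $M_n$ is the set of $n\times n$ complex matrices and $S_n$ is the set of symmetric matrices in $M_n$ (those with $A^t=A$). $I$ is the $n\times n$ identity matrix, $A^t$ is the transpose of $A$, and $\alpha$ is a complex number. The map $\phi$ is not assumed linear.
   Formalization: It is assumed that α≠0 (for α=0 the zero map satisfies (1) and (3) but not (2) or (4)), and the two values of t in (4) are distinct and not the pair {0,1}, for which (4) does not imply (1) when n≥2. *)

theory Defs
  imports "HOL-Analysis.Analysis"
begin

definition sym_mats :: "(complex^'n^'n) set" where
  "sym_mats = {A. transpose A = A}"

(* HOL-Analysis offers only real scalar multiplication on complex matrices. *)
definition scale_mat :: "complex \<Rightarrow> complex^'n^'n \<Rightarrow> complex^'n^'n" where
  "scale_mat c A = (\<chi> i j. c * A $ i $ j)"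

definition scaled_congruence :: "complex \<Rightarrow> (complex^'n^'n \<Rightarrow> complex^'n^'n) \<Rightarrow> bool" where
  "scaled_congruence \<alpha> \<phi> \<longleftrightarrow>
     (\<exists>P :: complex^'n^'n. invertible P \<and> (det P)\<^sup>2 = 1 \<and>
        (\<forall>A\<in>sym_mats. \<phi> A = scale_mat \<alpha> (P ** A ** transpose P)))"

definition preserves_trace_quotient :: "(complex^'n^'n \<Rightarrow> complex^'n^'n) \<Rightarrow> bool" where
  "preserves_trace_quotient \<phi> \<longleftrightarrow>
     (\<forall>A\<in>sym_mats. \<forall>B\<in>sym_mats. invertible B \<longrightarrow>
        trace (\<phi> A ** matrix_inv (\<phi> B)) = trace (A ** matrix_inv B))"

definition det_combination_at ::
    "complex \<Rightarrow> (complex^'n^'n \<Rightarrow> complex^'n^'n) \<Rightarrow> real \<Rightarrow> bool" where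
  "det_combination_at \<alpha> \<phi> t \<longleftrightarrow>
     (\<forall>A\<in>sym_mats. \<forall>B\<in>sym_mats.
        det (t *\<^sub>R \<phi> A + (1 - t) *\<^sub>R \<phi> B)
          = \<alpha> ^ CARD('n) * det (t *\<^sub>R A + (1 - t) *\<^sub>R B))"

(* The pair {0, 1} is excluded: at t = 0 and t = 1 the identity only says
   det (\<phi> A) = \<alpha>^n * det A, which for n \<ge> 2 also holds for nonlinear surjections
   permuting symmetric matrices of equal determinant.  One of the two parameters
   may still be an endpoint. *)
definition det_combination_at_two ::
    "complex \<Rightarrow> (complex^'n^'n \<Rightarrow> complex^'n^'n) \<Rightarrow> bool" where
  "det_combination_at_two \<alpha> \<phi> \<longleftrightarrow>
     (\<exists>s\<in>{0..1}. \<exists>t\<in>{0..1}. s \<noteq> t \<and> {s, t} \<noteq> {0, 1} \<and>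
        det_combination_at \<alpha> \<phi> s \<and> det_combination_at \<alpha> \<phi> t)"

end

theory Submission
  imports Defs
begin

text \<open>
  If the trace condition holds, \<open>\<phi>\<close> is additive and homogeneous over the reals, because the
  trace form is nondegenerate and the inverses \<open>(\<phi> B)\<^sup>-\<^sup>1\<close> span the symmetric matrices.  With
  \<open>K = (\<phi> I)\<^sup>-\<^sup>1\<close>, evaluating the condition at \<open>B = I + s X\<close> for an idempotent \<open>X\<close> shows
  that \<open>\<phi> X\<close> is idempotent for the product \<open>X K Y\<close>.  The images of the diagonal matrix units
  thus provide a congruence after which \<open>\<phi>\<close> fixes \<open>I\<close> and all diagonal units; such a map
  is conjugation by a diagonal matrix of signs.

  The determinant condition on \<open>[0, 1]\<close> gives the trace condition by differentiating along lines.
  If only one \<open>t\<close> strictly between \<open>0\<close> and \<open>1\<close> is available, surjectivity shows that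
  \<open>\<phi>\<close> is differentiable at \<open>0\<close> along rays.  Its derivative there satisfies the determinant
  condition for all parameters, and then coincides with \<open>\<phi>\<close>.
\<close>

section \<open>Inverses, traces and determinants of square matrices\<close>

lemma matrix_inv_mult:
  fixes A :: "'a::semiring_1^'n^'n"
  assumes "invertible A"
  shows "A ** matrix_inv A = mat 1" "matrix_inv A ** A = mat 1"
proof -
  have "\<exists>B. A ** B = mat 1 \<and> B ** A = mat 1"
    using assms by (simp add: invertible_def)
  from someI_ex[OF this]
  show "A ** matrix_inv A = mat 1" "matrix_inv A ** A = mat 1"
    by (simp_all add: matrix_inv_def)
qed

lemma matrix_inv_unique:
  fixes A B :: "'a::field^'n^'n"
  assumes "A ** B = mat 1"
  shows "matrix_inv A = B" "invertible A"
proof -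
  show inv: "invertible A"
    using assms by (auto simp: invertible_right_inverse)
  have "matrix_inv A = matrix_inv A ** (A ** B)"
    by (simp add: assms)
  also have "\<dots> = B"
    by (simp only: matrix_mul_assoc matrix_inv_mult[OF inv] matrix_mul_lid)
  finally show "matrix_inv A = B" .
qed

lemma matrix_inv_mat_1 [simp]:
  "invertible (mat 1 :: 'a::field^'n^'n)" "matrix_inv (mat 1 :: 'a::field^'n^'n) = mat 1"
  using matrix_inv_unique[of "mat 1 :: 'a^'n^'n" "mat 1"] by simp_all

lemma invertible_matrix_inv:
  fixes A :: "'a::field^'n^'n"
  assumes "invertible A"
  shows "invertible (matrix_inv A)" "matrix_inv (matrix_inv A) = A"
  using matrix_inv_unique[OF matrix_inv_mult(2)[OF assms]] by auto

lemma matrix_inv_prod: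
  fixes A B :: "'a::field^'n^'n"
  assumes "invertible A" "invertible B"
  shows "matrix_inv (A ** B) = matrix_inv B ** matrix_inv A"
proof (rule matrix_inv_unique)
  have "A ** B ** (matrix_inv B ** matrix_inv A) = A ** (B ** matrix_inv B) ** matrix_inv A"
    by (simp only: matrix_mul_assoc)
  then show "A ** B ** (matrix_inv B ** matrix_inv A) = mat 1"
    by (simp add: assms matrix_inv_mult)
qed

lemma matrix_inv_transpose:
  fixes A :: "'a::field^'n^'n"
  assumes "invertible A"
  shows "matrix_inv (transpose A) = transpose (matrix_inv A)" "invertible (transpose A)"
proof -
  have "transpose A ** transpose (matrix_inv A) = mat 1"
    by (simp flip: matrix_transpose_mul add: assms matrix_inv_mult)
  from matrix_inv_unique[OF this]
  show "matrix_inv (transpose A) = transpose (matrix_inv A)" "invertible (transpose A)"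
    by auto
qed

lemma det_matrix_inv:
  fixes A :: "'a::field^'n^'n"
  assumes "invertible A"
  shows "det A * det (matrix_inv A) = 1"
  by (metis assms det_I det_mul matrix_inv_mult(1))

lemma matrix_mul_linear_simps:
  fixes A B C :: "'a::real_algebra_1^'n^'n"
  shows "A ** (B + C) = A ** B + A ** C" "(A + B) ** C = A ** C + B ** C"
    "A ** (B - C) = A ** B - A ** C" "(A - B) ** C = A ** C - B ** C"
    "A ** (- B) = - (A ** B)" "(- A) ** B = - (A ** B)"
    "(r *\<^sub>R A) ** B = r *\<^sub>R (A ** B)" "A ** (r *\<^sub>R B) = r *\<^sub>R (A ** B)"
  by (simp_all add: matrix_matrix_mult_def vec_eq_iff algebra_simps sum.distrib sum_subtractf
      sum_negf scaleR_sum_right)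

lemma transpose_linear_simps:
  "transpose (A + B) = transpose A + transpose (B :: 'a::real_algebra_1^'n^'n)"
  "transpose (A - B) = transpose A - transpose B"
  "transpose (- A) = - transpose A"
  "transpose (r *\<^sub>R A) = r *\<^sub>R transpose A"
  by (simp_all add: transpose_def vec_eq_iff)

lemma trace_linear_simps:
  fixes A B :: "complex^'n^'n"
  shows "trace (A + B) = trace A + trace B" "trace (A - B) = trace A - trace B"
    "trace (- A) = - trace A" "trace (r *\<^sub>R A) = r *\<^sub>R trace A" "trace (0 :: complex^'n^'n) = 0"
  by (simp_all add: trace_def sum.distrib sum_subtractf sum_negf scaleR_sum_right)

lemma trace_mult_eq: "trace (A ** B) = (\<Sum>i\<in>UNIV. \<Sum>j\<in>UNIV. A $ i $ j * B $ j $ i)"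
  for A B :: "complex^'n^'n"
  by (simp add: trace_def matrix_matrix_mult_def)

lemma trace_mult_rotate: "trace (A ** B ** C) = trace (C ** A ** B)"
  for A B C :: "complex^'n^'n"
  by (metis matrix_mul_assoc trace_mul_sym)

lemma det_scaleR: "det (r *\<^sub>R A) = of_real r ^ CARD('n) * det A"
  for A :: "complex^'n^'n"
proof -
  have "(\<Prod>i\<in>UNIV. (r *\<^sub>R A) $ i $ p i) = of_real r ^ CARD('n) * (\<Prod>i\<in>UNIV. A $ i $ p i)"
    for p :: "'n \<Rightarrow> 'n"
  proof -
    have "(r *\<^sub>R A) $ i $ j = of_real r * A $ i $ j" for i j
      by (simp add: scaleR_conv_of_real[of r "A $ i $ j"])
    then show ?thesis
      by (simp add: prod.distrib del: vector_scaleR_component)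
  qed
  then show ?thesis
    unfolding det_def sum_distrib_left by (intro sum.cong) simp_all
qed

subsection \<open>Symmetric matrices\<close>

lemma sym_matsD: "A \<in> sym_mats \<Longrightarrow> transpose A = A"
  and sym_matsI: "transpose A = A \<Longrightarrow> A \<in> sym_mats"
  by (simp_all add: sym_mats_def)

lemma sym_mats_comm: "A \<in> sym_mats \<Longrightarrow> A $ i $ j = A $ j $ i"
  by (metis (mono_tags, lifting) sym_matsD transpose_def vec_lambda_beta)

lemma subspace_sym_mats: "subspace (sym_mats :: (complex^'n^'n) set)"
  by (auto simp: subspace_def sym_mats_def transpose_linear_simps)
    (simp add: transpose_def vec_eq_iff)

lemmas sym_mats_closed [simp, intro] =
  subspace_add[OF subspace_sym_mats] subspace_diff[OF subspace_sym_mats]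
  subspace_scale[OF subspace_sym_mats] subspace_0[OF subspace_sym_mats]
  subspace_neg[OF subspace_sym_mats]

lemma sym_mats_mat [simp, intro]: "mat c \<in> sym_mats"
  by (simp add: sym_mats_def)

lemma sym_mats_inv [simp, intro]:
  "A \<in> sym_mats \<Longrightarrow> invertible A \<Longrightarrow> matrix_inv A \<in> sym_mats"
  by (metis matrix_inv_transpose(1) sym_matsD sym_matsI)

lemma sym_mats_congruence [simp, intro]:
  "A \<in> sym_mats \<Longrightarrow> P ** A ** transpose P \<in> sym_mats"
  by (auto intro!: sym_matsI simp: matrix_transpose_mul sym_matsD matrix_mul_assoc)

text \<open>The form is bilinear and not definite, so \<open>X\<close> is paired with its entrywise
  conjugate: this is again symmetric, and the trace becomes the sum of the squared moduli of the
  entries.\<close>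

lemma sym_mats_trace_nondegenerate:
  fixes X :: "complex^'n^'n"
  assumes "\<And>Y. Y \<in> sym_mats \<Longrightarrow> trace (X ** Y) = 0" "X \<in> sym_mats"
  shows "X = 0"
proof -
  define Y where "Y = (\<chi> i j. cnj (X $ i $ j))"
  have sym: "X $ i $ j = X $ j $ i" for i j
    using assms(2) by (rule sym_mats_comm)
  have "Y \<in> sym_mats"
    using sym by (auto simp: sym_mats_def Y_def transpose_def vec_eq_iff)
  then have "0 = Re (trace (X ** Y))"
    using assms(1) by simp
  also have "\<dots> = (\<Sum>i\<in>UNIV. \<Sum>j\<in>UNIV. (cmod (X $ i $ j))\<^sup>2)"
    using sym by (simp add: trace_mult_eq Y_def complex_mult_cnj cmod_power2 flip: power2_eq_square)
  finally have "\<forall>i. (\<Sum>j\<in>UNIV. (cmod (X $ i $ j))\<^sup>2) = 0"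
    by (subst (asm) eq_commute) (simp add: sum_nonneg sum_nonneg_eq_0_iff)
  then show ?thesis
    by (simp add: sum_nonneg_eq_0_iff vec_eq_iff)
qed

subsection \<open>The determinant near an invertible matrix\<close>

lemma tendsto_det:
  fixes M :: "'a \<Rightarrow> complex^'n^'n"
  assumes "(M \<longlongrightarrow> L) F"
  shows "((\<lambda>s. det (M s)) \<longlongrightarrow> det L) F"
  unfolding det_def by (intro tendsto_intros assms)

text \<open>The product rule applied to the Leibniz expansion; it holds at singular base points as
  well.\<close>

lemma has_vector_derivative_det:
  fixes M :: "real \<Rightarrow> complex^'n^'n"
  assumes "\<And>i j. ((\<lambda>s. M s $ i $ j) has_vector_derivative M' $ i $ j) (at x within S)"
  shows "((\<lambda>s. det (M s)) has_vector_derivative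
    (\<Sum>p\<in>{p. p permutes UNIV}. of_int (sign p) *
      (\<Sum>i\<in>UNIV. M' $ i $ p i * (\<Prod>j\<in>UNIV - {i}. M x $ j $ p j)))) (at x within S)"
proof -
  have "((\<lambda>s. \<Prod>i\<in>UNIV. M s $ i $ p i) has_vector_derivative
      (\<Sum>i\<in>UNIV. M' $ i $ p i * (\<Prod>j\<in>UNIV - {i}. M x $ j $ p j))) (at x within S)" for p
    using has_derivative_prod[of UNIV "\<lambda>i s. M s $ i $ p i" "\<lambda>i s. s *\<^sub>R M' $ i $ p i" x S] assms
    by (simp add: has_vector_derivative_def scaleR_sum_right)
  then show ?thesis
    unfolding det_def by (intro derivative_intros) auto
qed

lemma has_vector_derivative_det_mat_1:
  fixes M :: "real \<Rightarrow> complex^'n^'n"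
  assumes M: "\<And>i j. ((\<lambda>s. M s $ i $ j) has_vector_derivative M' $ i $ j) (at x within S)"
    and M1: "M x = mat 1"
  shows "((\<lambda>s. det (M s)) has_vector_derivative trace M') (at x within S)"
proof -
  let ?f = "\<lambda>p. of_int (sign p) * (\<Sum>i\<in>UNIV. M' $ i $ p i * (\<Prod>j\<in>UNIV - {i}. M x $ j $ p j))"
  have "?f p = 0" if p: "p permutes UNIV" "p \<noteq> id" for p
  proof -
    obtain k where k: "k \<noteq> p k"
      using p(2) unfolding fun_eq_iff id_apply by metis
    have k2: "p k \<noteq> p (p k)"
      using k permutes_inj[OF p(1)] by (simp add: inj_eq)
    \<comment> \<open>a permutation other than the identity moves at least two points\<close>
    have "\<exists>j\<in>UNIV - {i}. M x $ j $ p j = 0" for i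
    proof (cases "k = i")
      case True
      then show ?thesis
        using k k2 by (intro bexI[of _ "p k"]) (simp_all add: M1 mat_def)
    next
      case False
      then show ?thesis
        using k by (intro bexI[of _ k]) (simp_all add: M1 mat_def)
    qed
    then have "(\<Prod>j\<in>UNIV - {i}. M x $ j $ p j) = 0" for i
      by (intro prod_zero) simp_all
    then show ?thesis
      by (simp only: mult_zero_right sum.neutral_const)
  qed
  then have "(\<Sum>p\<in>{p. p permutes UNIV}. ?f p) = (\<Sum>p\<in>{id}. ?f p)"
    by (intro sum.mono_neutral_right) (simp_all add: permutes_id)
  also have "\<dots> = trace M'"
    by (simp add: M1 mat_def trace_def)
  finally show ?thesis
    using has_vector_derivative_det[OF M] by simp
qed

text \<open>Jacobi's formula. Multiplying by the constant inverse of \<open>M x\<close> moves the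
  base point to the identity, where the derivative of the determinant is the trace.\<close>

lemma has_vector_derivative_det_invertible:
  fixes M :: "real \<Rightarrow> complex^'n^'n"
  assumes M: "\<And>i j. ((\<lambda>s. M s $ i $ j) has_vector_derivative M' $ i $ j) (at x within S)"
    and inv: "invertible (M x)"
  shows "((\<lambda>s. det (M s)) has_vector_derivative det (M x) * trace (M' ** matrix_inv (M x))) (at x within S)"
proof -
  let ?N = "matrix_inv (M x)"
  have "((\<lambda>s. (?N ** M s) $ i $ j) has_vector_derivative (?N ** M') $ i $ j) (at x within S)" for i j
    by (simp add: matrix_matrix_mult_def) (intro derivative_intros M)
  then have "((\<lambda>s. det (?N ** M s)) has_vector_derivative trace (?N ** M')) (at x within S)"
    by (rule has_vector_derivative_det_mat_1) (simp add: matrix_inv_mult inv)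
  then have "((\<lambda>s. det (M x) * det (?N ** M s)) has_vector_derivative
      det (M x) * trace (?N ** M')) (at x within S)"
    by (rule bounded_linear.has_vector_derivative[OF bounded_linear_mult_right])
  moreover have "det (M x) * det (?N ** M s) = det (M s)" for s
    using det_matrix_inv[OF inv] by (metis det_mul mult.assoc mult_1)
  ultimately show ?thesis
    by (simp only: trace_mul_sym[of M'])
qed

lemma pencil_entry_derivative:
  fixes A B :: "complex^'n^'n"
  shows "((\<lambda>s. (s *\<^sub>R A + B) $ i $ j) has_vector_derivative A $ i $ j) (at x within S)"
  by (auto intro!: derivative_eq_intros)

lemma has_vector_derivative_det_pencil:
  fixes A B :: "complex^'n^'n"
  assumes "invertible B"
  shows "((\<lambda>s. det (s *\<^sub>R A + B)) has_vector_derivative det B * trace (A ** matrix_inv B)) (at 0 within S)"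
  using has_vector_derivative_det_invertible[OF pencil_entry_derivative, of 0 A B S] assms by simp

subsection \<open>The trace form on symmetric matrices\<close>

text \<open>The determinant tends to 1 as \<open>r\<close> decreases to 0, so it is nonzero for some
  small positive \<open>r\<close>.\<close>

lemma invertible_mat_1_plus:
  fixes F :: "complex^'n^'n"
  obtains r where "r > 0" "invertible (mat 1 + r *\<^sub>R F)"
proof -
  have "((\<lambda>r. mat 1 + r *\<^sub>R F) \<longlongrightarrow> mat 1 + 0 *\<^sub>R F) (at_right (0::real))"
    by (intro tendsto_add tendsto_const tendsto_scaleR tendsto_ident_at)
  from tendsto_det[OF this] have lim: "((\<lambda>r. det (mat 1 + r *\<^sub>R F)) \<longlongrightarrow> 1) (at_right (0::real))"
    by simp
  have "\<forall>\<^sub>F r in at_right (0::real). det (mat 1 + r *\<^sub>R F) \<noteq> 0"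
    using lim by (rule tendsto_imp_eventually_ne) simp
  then have "\<forall>\<^sub>F r in at_right (0::real). det (mat 1 + r *\<^sub>R F) \<noteq> 0 \<and> r > 0"
    by (rule eventually_conj) (rule eventually_at_right_less)
  from eventually_happens'[OF trivial_limit_at_right_real this] obtain r where
    "det (mat 1 + r *\<^sub>R F) \<noteq> 0" "r > 0"
    by (elim exE conjE)
  then show ?thesis
    using that[of r] by (simp add: invertible_det_nz)
qed

text \<open>Every symmetric \<open>F\<close> is a real multiple of the difference of the invertible
  matrices \<open>mat 1 + r *\<^sub>R F\<close> and \<open>mat 1\<close>. Linear tests may therefore
  be restricted to invertible matrices.\<close>

lemma sym_mats_subset_span_invertible:
  "(sym_mats :: (complex^'n^'n) set) \<subseteq> span {C \<in> sym_mats. invertible C}"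
proof
  fix F :: "complex^'n^'n"
  assume F: "F \<in> sym_mats"
  obtain r where r: "r > 0" "invertible (mat 1 + r *\<^sub>R F)"
    by (rule invertible_mat_1_plus)
  have "(1 / r) *\<^sub>R ((mat 1 + r *\<^sub>R F) - mat 1) \<in> span {C \<in> sym_mats. invertible C}"
    using r F by (intro span_scale span_diff span_base) auto
  then show "F \<in> span {C \<in> sym_mats. invertible C}"
    using r by simp
qed

lemma trace_mult_zero_span:
  fixes X :: "complex^'n^'n"
  assumes "\<And>b. b \<in> T \<Longrightarrow> trace (X ** b) = 0" "y \<in> span T"
  shows "trace (X ** y) = 0"
proof -
  have "subspace {y. trace (X ** y) = 0}"
    by (simp add: subspace_def matrix_mul_linear_simps trace_linear_simps)
  then have "span T \<subseteq> {y. trace (X ** y) = 0}"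
    using assms(1) by (intro span_minimal) auto
  then show ?thesis
    using assms(2) by auto
qed

lemma invertible_trace_nondegenerate:
  fixes X :: "complex^'n^'n"
  assumes "X \<in> sym_mats" "\<And>C. C \<in> sym_mats \<Longrightarrow> invertible C \<Longrightarrow> trace (X ** C) = 0"
  shows "X = 0"
proof (rule sym_mats_trace_nondegenerate[OF _ assms(1)])
  fix Y :: "complex^'n^'n"
  assume "Y \<in> sym_mats"
  then have "Y \<in> span {C \<in> sym_mats. invertible C}"
    using sym_mats_subset_span_invertible by (rule rev_subsetD)
  then show "trace (X ** Y) = 0"
    by (rule trace_mult_zero_span[rotated]) (simp add: assms(2))
qed

text \<open>The image under \<open>f\<close> of a basis contained in \<open>T\<close> is again linearly independent,
  hence again a basis.\<close>

lemma trace_nondegenerate_transfer: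
  fixes f :: "complex^'n^'n \<Rightarrow> complex^'n^'n"
  assumes T: "T \<subseteq> sym_mats" "sym_mats \<subseteq> span T" and f: "\<And>a. a \<in> T \<Longrightarrow> f a \<in> sym_mats"
    and tr: "\<And>a b. a \<in> T \<Longrightarrow> b \<in> U \<Longrightarrow> trace (f a ** g b) = trace (a ** k b)"
    and nd: "\<And>Z. Z \<in> sym_mats \<Longrightarrow> (\<And>b. b \<in> U \<Longrightarrow> trace (Z ** k b) = 0) \<Longrightarrow> Z = 0"
    and X: "X \<in> sym_mats" "\<And>a. a \<in> T \<Longrightarrow> trace (X ** f a) = 0"
  shows "X = 0"
proof -
  obtain B where B: "B \<subseteq> T" "independent B" "T \<subseteq> span B"
    by (rule maximal_independent_subset)
  have fin: "finite B"
    using B(2) by (rule finiteI_independent)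
  have span: "sym_mats \<subseteq> span B"
    using T(2) B(3) by (meson order_trans span_minimal subspace_span)
  \<comment> \<open>A linear relation among the \<open>f b\<close> passes through \<open>tr\<close>
    to the same relation among the \<open>b\<close>, tested against every \<open>k c\<close>; then
    \<open>nd\<close> applies.\<close>
  have sum_zero: "(\<Sum>b\<in>B. u b *\<^sub>R b) = 0" if u: "(\<Sum>b\<in>B. u b *\<^sub>R f b) = 0" for u
  proof (rule nd)
    show "(\<Sum>b\<in>B. u b *\<^sub>R b) \<in> sym_mats"
      using B(1) T(1) subspace_sym_mats by (intro subspace_sum subspace_scale) auto
    have lin: "trace ((\<Sum>b\<in>B. u b *\<^sub>R h b) ** Y) = (\<Sum>b\<in>B. u b *\<^sub>R trace (h b ** Y))"
      for h :: "_ \<Rightarrow> complex^'n^'n" and Y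
      using fin by (induction B) (simp_all add: matrix_mul_linear_simps trace_linear_simps)
    show "trace ((\<Sum>b\<in>B. u b *\<^sub>R b) ** k c) = 0" if "c \<in> U" for c
    proof -
      have "trace ((\<Sum>b\<in>B. u b *\<^sub>R b) ** k c) = trace ((\<Sum>b\<in>B. u b *\<^sub>R f b) ** g c)"
        unfolding lin using B(1) tr that by (intro sum.cong) auto
      then show ?thesis
        by (simp add: u trace_linear_simps)
    qed
  qed
  have inj: "inj_on f B"
  proof (rule inj_onI)
    fix a a' assume a: "a \<in> B" "a' \<in> B" "f a = f a'"
    have "a - a' = 0"
    proof (rule nd)
      show "a - a' \<in> sym_mats"
        using a B(1) T(1) by auto
      show "trace ((a - a') ** k b) = 0" if "b \<in> U" for b
        using tr[OF subsetD[OF B(1) a(1)] that] tr[OF subsetD[OF B(1) a(2)] that] a(3)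
        by (simp add: matrix_mul_linear_simps trace_linear_simps)
    qed
    then show "a = a'"
      by simp
  qed
  have "independent (f ` B)"
  proof
    assume "dependent (f ` B)"
    then obtain u where u: "\<exists>b\<in>B. u (f b) \<noteq> 0" "(\<Sum>b\<in>B. u (f b) *\<^sub>R f b) = 0"
      using fin inj by (auto simp: dependent_finite sum.reindex)
    then show False
      using sum_zero[of "\<lambda>b. u (f b)"] B(2) fin by (auto simp: dependent_finite)
  qed
  \<comment> \<open>An independent subset with as many elements as the dimension of the space spans
    it.\<close>
  moreover have "card (f ` B) = dim (sym_mats :: (complex^'n^'n) set)"
    using basis_card_eq_dim[of B sym_mats] B T(1) span inj by (auto simp: card_image)
  ultimately have "sym_mats \<subseteq> span (f ` B)"
    using f B(1) by (intro card_ge_dim_independent) auto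
  then have "trace (X ** Y) = 0" if "Y \<in> sym_mats" for Y
    using that X(2) B(1) by (intro trace_mult_zero_span[of "f ` B" X Y]) blast+
  then show ?thesis
    using X(1) by (intro sym_mats_trace_nondegenerate)
qed

text \<open>A map with an adjoint for a nondegenerate form is linear, because the defect of
  linearity pairs to zero with every \<open>g C\<close>. No linearity of \<open>g\<close> is
  assumed.\<close>

lemma trace_adjoint_linear:
  fixes f :: "complex^'n^'n \<Rightarrow> complex^'n^'n"
  assumes f: "\<And>A. A \<in> sym_mats \<Longrightarrow> f A \<in> sym_mats"
    and g: "\<And>C. C \<in> sym_mats \<Longrightarrow> invertible C \<Longrightarrow> g C \<in> sym_mats"
    and tr: "\<And>A C. A \<in> sym_mats \<Longrightarrow> C \<in> sym_mats \<Longrightarrow> invertible C \<Longrightarrow> trace (f A ** g C) = trace (A ** C)"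
    and A: "A \<in> sym_mats"
  shows "B \<in> sym_mats \<Longrightarrow> f (A + B) = f A + f B" "f (r *\<^sub>R A) = r *\<^sub>R f A"
proof -
  \<comment> \<open>The transfer lemma is applied with the roles of \<open>f\<close> and
    \<open>g\<close> exchanged, which makes the values of \<open>g\<close> a separating
    family.\<close>
  have nd: "X = 0" if X: "X \<in> sym_mats" "\<And>C. C \<in> sym_mats \<Longrightarrow> invertible C \<Longrightarrow> trace (X ** g C) = 0" for X
  proof (rule trace_nondegenerate_transfer[where f = g and g = f and k = "\<lambda>b. b"
        and T = "{C \<in> sym_mats. invertible C}" and U = sym_mats])
    show "trace (g a ** f b) = trace (a ** b)" if "a \<in> {C \<in> sym_mats. invertible C}" "b \<in> sym_mats" for a b
      using that tr[of b a] by (simp add: trace_mul_sym[of "g a"] trace_mul_sym[of a])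
    show "Z = 0" if "Z \<in> sym_mats" "\<And>b. b \<in> sym_mats \<Longrightarrow> trace (Z ** b) = 0" for Z
      using that(2,1) by (rule sym_mats_trace_nondegenerate)
    show "trace (X ** g a) = 0" if "a \<in> {C \<in> sym_mats. invertible C}" for a
      using that by (simp add: X(2))
    show "g a \<in> sym_mats" if "a \<in> {C \<in> sym_mats. invertible C}" for a
      using that g by simp
  qed (rule Collect_restrict sym_mats_subset_span_invertible X(1))+
  show "f (A + B) = f A + f B" if B: "B \<in> sym_mats"
  proof -
    have "f (A + B) - (f A + f B) = 0"
      by (rule nd) (use A B f in \<open>auto simp: matrix_mul_linear_simps trace_linear_simps tr\<close>)
    then show ?thesis
      by simp
  qed
  have "f (r *\<^sub>R A) - r *\<^sub>R f A = 0"
    by (rule nd) (use A f in \<open>auto simp: matrix_mul_linear_simps trace_linear_simps tr\<close>)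
  then show "f (r *\<^sub>R A) = r *\<^sub>R f A"
    by simp
qed

subsection \<open>Maps preserving the trace of quotients\<close>

text \<open>Expanding the square of the sum gives \<open>P ** Q = - (Q ** P)\<close>. Multiplying by
  \<open>P\<close> on the left then yields \<open>P ** Q = Q ** P\<close>, so the product equals its
  own negative.\<close>

lemma idempotents_sum_orthogonal:
  fixes P Q :: "complex^'n^'n"
  assumes "P ** P = P" "Q ** Q = Q" "(P + Q) ** (P + Q) = P + Q"
  shows "P ** Q = 0"
proof -
  have anti: "P ** Q = - (Q ** P)"
    using assms by (simp add: matrix_mul_linear_simps algebra_simps eq_neg_iff_add_eq_0)
  have "P ** Q = P ** (P ** Q)"
    by (simp add: matrix_mul_assoc assms)
  also have "\<dots> = - (P ** Q ** P)"
    by (simp add: anti matrix_mul_linear_simps matrix_mul_assoc)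
  also have "\<dots> = Q ** P"
    by (simp add: anti matrix_mul_linear_simps assms flip: matrix_mul_assoc)
  finally have "P ** Q = - (P ** Q)"
    using anti by simp
  then have "2 *\<^sub>R (P ** Q) = 0"
    by (simp add: scaleR_2 eq_neg_iff_add_eq_0)
  then show ?thesis
    by simp
qed

text \<open>Statement (2) as a locale, so that its consequences are available for \<phi>, for maps
  congruent to it, and for its derivative at 0.\<close>

locale trace_quotient_preserver =
  fixes \<phi> :: "complex^'n^'n \<Rightarrow> complex^'n^'n"
  assumes maps [simp, intro]: "A \<in> sym_mats \<Longrightarrow> \<phi> A \<in> sym_mats"
    and inv [simp, intro]: "A \<in> sym_mats \<Longrightarrow> invertible A \<Longrightarrow> invertible (\<phi> A)"
    and tr: "A \<in> sym_mats \<Longrightarrow> B \<in> sym_mats \<Longrightarrow> invertible B \<Longrightarrow>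
      trace (\<phi> A ** matrix_inv (\<phi> B)) = trace (A ** matrix_inv B)"
begin

text \<open>Substituting the inverse of \<open>C\<close> for \<open>B\<close> turns the trace of a
  quotient into the trace form and exhibits an adjoint of \<phi>.\<close>

lemma real_linear:
  assumes A: "A \<in> sym_mats"
  shows "B \<in> sym_mats \<Longrightarrow> \<phi> (A + B) = \<phi> A + \<phi> B" "\<phi> (r *\<^sub>R A) = r *\<^sub>R \<phi> A"
proof -
  let ?g = "\<lambda>C. matrix_inv (\<phi> (matrix_inv C))"
  have g: "?g C \<in> sym_mats" if "C \<in> sym_mats" "invertible C" for C
    using that by (auto simp: invertible_matrix_inv)
  have "trace (\<phi> A ** ?g C) = trace (A ** C)"
    if "A \<in> sym_mats" "C \<in> sym_mats" "invertible C" for A C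
    using tr[of A "matrix_inv C"] that by (simp add: invertible_matrix_inv)
  from trace_adjoint_linear[of \<phi> ?g, OF maps g this A]
  show "B \<in> sym_mats \<Longrightarrow> \<phi> (A + B) = \<phi> A + \<phi> B" "\<phi> (r *\<^sub>R A) = r *\<^sub>R \<phi> A"
    by blast+
qed

lemma nondegenerate:
  assumes "X \<in> sym_mats" "\<And>A. A \<in> sym_mats \<Longrightarrow> trace (\<phi> A ** X) = 0"
  shows "X = 0"
proof (rule trace_nondegenerate_transfer[where f = \<phi> and T = sym_mats
      and U = "{B \<in> sym_mats. invertible B}" and g = "\<lambda>B. matrix_inv (\<phi> B)" and k = matrix_inv])
  fix Z :: "complex^'n^'n"
  assume Z: "Z \<in> sym_mats" "\<And>b. b \<in> {B \<in> sym_mats. invertible B} \<Longrightarrow> trace (Z ** matrix_inv b) = 0"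
  show "Z = 0"
  proof (rule invertible_trace_nondegenerate)
    show "trace (Z ** C) = 0" if "C \<in> sym_mats" "invertible C" for C
      using Z(2)[of "matrix_inv C"] that by (simp add: invertible_matrix_inv)
  qed (rule Z)
next
  show "trace (\<phi> a ** matrix_inv (\<phi> b)) = trace (a ** matrix_inv b)"
    if "a \<in> sym_mats" "b \<in> {B \<in> sym_mats. invertible B}" for a b
    using that tr by simp
qed (simp_all add: assms trace_mul_sym[of X] span_superset)

abbreviation "J \<equiv> \<phi> (mat 1)"
abbreviation "K \<equiv> matrix_inv (\<phi> (mat 1))"

lemma invertible_J [simp]: "invertible J"
  by (simp add: inv)

lemma J_K [simp]: "J ** K = mat 1" "K ** J = mat 1"
  by (simp_all add: matrix_inv_mult)

text \<open>For idempotent \<open>X\<close> the inverse of \<open>1 + s X\<close> is \<open>1 - s / (1 + s) X\<close>; comparing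
  the trace condition at \<open>B = 1 + s X\<close> for \<open>s = 1\<close> and \<open>s = 2\<close> determines \<open>(\<phi> B)\<^sup>-\<^sup>1\<close>.\<close>

lemma idempotent:
  assumes X: "X \<in> sym_mats" "X ** X = X"
  shows "\<phi> X ** K ** \<phi> X = \<phi> X"
    and "A \<in> sym_mats \<Longrightarrow> trace (\<phi> A ** (K ** \<phi> X ** K)) = trace (A ** X)"
proof -
  define Y where "Y = \<phi> X"
  \<comment> \<open>The scaling makes the trace pairing of \<open>V s\<close> with the values of
    \<phi> independent of \<open>s\<close>; \<open>V s\<close> will turn out to be
    \<open>K ** Y ** K\<close>.\<close>
  define V where "V s = ((1 + s) / s) *\<^sub>R (K - matrix_inv (J + s *\<^sub>R Y))" for s
  have [simp]: "Y \<in> sym_mats"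
    using X by (simp add: Y_def)
  have props: "V s \<in> sym_mats" "trace (\<phi> A ** V s) = trace (A ** X)"
    "(1 + s) *\<^sub>R (Y ** K) - J ** V s - s *\<^sub>R (Y ** V s) = 0"
    if s: "s > 0" and A: "A \<in> sym_mats" for s A
  proof -
    define B where "B = mat 1 + s *\<^sub>R X"
    have "B ** (mat 1 - (s / (1 + s)) *\<^sub>R X) = mat 1 + (s - s / (1 + s) - s * s / (1 + s)) *\<^sub>R X"
      by (simp add: B_def matrix_mul_linear_simps X algebra_simps)
    also have "s - s / (1 + s) - s * s / (1 + s) = 0"
      using s by (simp add: field_simps)
    finally have B: "B ** (mat 1 - (s / (1 + s)) *\<^sub>R X) = mat 1"
      by simp
    have BS: "B \<in> sym_mats"
      using X by (simp add: B_def)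
    have "\<phi> B = J + s *\<^sub>R Y"
      by (simp add: B_def real_linear X Y_def)
    then have inv: "invertible (J + s *\<^sub>R Y)"
      using inv[OF BS] matrix_inv_unique[OF B] by simp
    show "V s \<in> sym_mats"
      using inv by (auto simp: V_def)
    have "trace (\<phi> A ** matrix_inv (J + s *\<^sub>R Y)) = trace (A ** (mat 1 - (s / (1 + s)) *\<^sub>R X))"
      using tr[OF A BS] matrix_inv_unique[OF B] \<open>\<phi> B = _\<close> by simp
    moreover have "trace (\<phi> A ** K) = trace A"
      using tr[OF A sym_mats_mat, of 1] by simp
    ultimately have "trace (\<phi> A ** V s) = ((1 + s) / s) *\<^sub>R (s / (1 + s)) *\<^sub>R trace (A ** X)"
      by (simp only: V_def matrix_mul_linear_simps trace_linear_simps matrix_mul_rid) simp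
    then show "trace (\<phi> A ** V s) = trace (A ** X)"
      using s by simp
    have "matrix_inv (J + s *\<^sub>R Y) = K - (s / (1 + s)) *\<^sub>R V s"
      using s by (simp add: V_def)
    then have "(J + s *\<^sub>R Y) ** (K - (s / (1 + s)) *\<^sub>R V s) = mat 1"
      using matrix_inv_mult[OF inv] by simp
    then have "s *\<^sub>R (Y ** K) - (s / (1 + s)) *\<^sub>R (J ** V s) - s *\<^sub>R (s / (1 + s)) *\<^sub>R (Y ** V s) = 0"
      by (simp only: matrix_mul_linear_simps J_K) (simp add: algebra_simps)
    then have "((1 + s) / s) *\<^sub>R (s *\<^sub>R (Y ** K) - (s / (1 + s)) *\<^sub>R (J ** V s)
        - s *\<^sub>R (s / (1 + s)) *\<^sub>R (Y ** V s)) = 0"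
      by simp
    then show "(1 + s) *\<^sub>R (Y ** K) - J ** V s - s *\<^sub>R (Y ** V s) = 0"
      using s by (simp add: scaleR_diff_right)
  qed
  \<comment> \<open>Both matrices have the same pairing with every value of \<phi>, and these values
    separate symmetric matrices.\<close>
  have "V 1 - V 2 = 0"
    by (rule nondegenerate) (use X(1) in
        \<open>auto simp: matrix_mul_linear_simps trace_linear_simps props(1)[of _ X] props(2)\<close>)
  then have "V 2 = V 1"
    by simp
  then have eqs: "2 *\<^sub>R (Y ** K) - J ** V 1 - Y ** V 1 = 0" "3 *\<^sub>R (Y ** K) - J ** V 1 - 2 *\<^sub>R (Y ** V 1) = 0"
    using props(3)[of 1 X] props(3)[of 2 X] X by simp_all
  \<comment> \<open>The two equations form a linear system for \<open>J ** V 1\<close> and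
    \<open>Y ** V 1\<close> whose only solution has both equal to \<open>Y ** K\<close>.\<close>
  have "(Y ** V 1) $ i $ j = (Y ** K) $ i $ j \<and> (J ** V 1) $ i $ j = (Y ** K) $ i $ j" for i j
    using arg_cong[OF eqs(1), of "\<lambda>M. M $ i $ j"] arg_cong[OF eqs(2), of "\<lambda>M. M $ i $ j"]
    by (simp add: complex_eq_iff)
  then have YV: "Y ** V 1 = Y ** K" and JV: "J ** V 1 = Y ** K"
    by (simp_all add: vec_eq_iff)
  have "V 1 = K ** (J ** V 1)"
    by (simp add: matrix_mul_assoc)
  then have V: "V 1 = K ** Y ** K"
    by (simp add: JV matrix_mul_assoc)
  have "Y ** K ** Y ** K ** J = Y ** K ** J"
    using YV by (simp add: V matrix_mul_assoc)
  then show "\<phi> X ** K ** \<phi> X = \<phi> X"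
    by (simp add: Y_def flip: matrix_mul_assoc)
  show "trace (\<phi> A ** (K ** \<phi> X ** K)) = trace (A ** X)" if "A \<in> sym_mats"
    using props(2)[of 1 A] that by (simp add: V Y_def)
qed

text \<open>Left multiplication by \<open>K\<close> turns idempotents for the product
  \<open>X K Y\<close> into ordinary ones. Since \<open>X + Y\<close> is idempotent too, the lemma
  on sums of idempotents applies.\<close>

lemma orthogonal_idempotents:
  assumes X: "X \<in> sym_mats" "X ** X = X" and Y: "Y \<in> sym_mats" "Y ** Y = Y"
    and "X ** Y = 0" "Y ** X = 0"
  shows "\<phi> X ** K ** \<phi> Y = 0"
proof -
  have idem: "K ** \<phi> Z ** (K ** \<phi> Z) = K ** \<phi> Z" if "Z \<in> sym_mats" "Z ** Z = Z" for Z
    using idempotent(1)[OF that] by (simp flip: matrix_mul_assoc)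
  have "(X + Y) ** (X + Y) = X + Y"
    by (simp add: matrix_mul_linear_simps assms)
  then have "(K ** \<phi> X) ** (K ** \<phi> Y) = 0"
    using idem[of X] idem[of Y] idem[of "X + Y"] X Y
    by (intro idempotents_sum_orthogonal) (simp_all add: real_linear matrix_mul_linear_simps)
  then have "J ** (K ** \<phi> X ** (K ** \<phi> Y)) = 0"
    by simp
  then show ?thesis
    by (simp add: matrix_mul_assoc)
qed

end

section \<open>Averaging projections and maps that fix the diagonal units\<close>

definition averaging :: "'n set \<Rightarrow> complex^'n^'n" where
  "averaging I = (\<chi> a b. if a \<in> I \<and> b \<in> I then 1 / of_nat (card I) else 0)"

lemma averaging_nth: "averaging I $ a $ b = (if a \<in> I \<and> b \<in> I then 1 / of_nat (card I) else 0)"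
  by (simp add: averaging_def)

lemma averaging_sym [simp]: "averaging I \<in> sym_mats"
  by (simp add: sym_mats_def transpose_def averaging_def vec_eq_iff)

text \<open>For nonempty \<open>I\<close> this is the orthogonal projection onto the line of the
  indicator vector of \<open>I\<close>. Singletons give the diagonal matrix units; larger sets give
  idempotents that detect off-diagonal entries.\<close>

lemma averaging_idempotent [simp]:
  fixes I :: "'n::finite set"
  shows "averaging I ** averaging I = averaging I"
proof (cases "I = {}")
  case False
  have "(\<Sum>c\<in>UNIV. averaging I $ a $ c * averaging I $ c $ b) =
      (\<Sum>c\<in>I. averaging I $ a $ c * averaging I $ c $ b)" for a b
    by (rule sum.mono_neutral_right) (simp_all add: averaging_nth)
  with False show ?thesis
    by (simp add: vec_eq_iff matrix_matrix_mult_def averaging_nth card_eq_0_iff)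
qed (simp add: vec_eq_iff matrix_matrix_mult_def averaging_nth)

lemma averaging_disjoint:
  fixes I J :: "'n::finite set"
  assumes "I \<inter> J = {}"
  shows "averaging I ** averaging J = 0"
proof -
  have "averaging I $ a $ c * averaging J $ c $ b = 0" for a b c
    using assms by (cases "c \<in> I") (auto simp: averaging_nth)
  then show ?thesis
    by (simp only: vec_eq_iff matrix_matrix_mult_def vec_lambda_beta sum.neutral_const zero_index) simp
qed

lemma trace_averaging_singleton: "trace (A ** averaging {k}) = A $ k $ k"
proof -
  have "A $ i $ j * averaging {k} $ j $ i = (if j = k then if i = k then A $ k $ k else 0 else 0)" for i j
    by (simp add: averaging_nth)
  then show ?thesis
    by (simp add: trace_mult_eq)
qed

lemma averaging_singleton_mult_nth: "(averaging {k} ** A) $ k $ b = A $ k $ b"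
proof -
  have "averaging {k} $ k $ c * A $ c $ b = (if c = k then A $ k $ b else 0)" for c
    by (simp add: averaging_nth)
  then show ?thesis
    by (simp add: matrix_matrix_mult_def)
qed

lemma sum_supported_pair:
  fixes f :: "'n::finite \<Rightarrow> complex"
  assumes "k \<noteq> l" "\<And>m. m \<noteq> k \<Longrightarrow> m \<noteq> l \<Longrightarrow> f m = 0"
  shows "(\<Sum>m\<in>UNIV. f m) = f k + f l"
proof -
  have "(\<Sum>m\<in>UNIV. f m) = (\<Sum>m\<in>{k, l}. f m)"
    using assms(2) by (intro sum.mono_neutral_right) auto
  then show ?thesis
    using assms(1) by simp
qed

lemma trace_mult_supported_pair:
  fixes A H :: "complex^'n^'n"
  assumes "k \<noteq> l" "A \<in> sym_mats" "H \<in> sym_mats" "\<And>m b. m \<noteq> k \<Longrightarrow> m \<noteq> l \<Longrightarrow> H $ m $ b = 0"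
  shows "trace (A ** H) = A $ k $ k * H $ k $ k + A $ l $ l * H $ l $ l + 2 * (A $ k $ l * H $ k $ l)"
proof -
  have H: "H $ b $ m = 0" if "m \<noteq> k" "m \<noteq> l" for m b
    using assms(4)[OF that] sym_mats_comm[OF assms(3)] by metis
  have "(\<Sum>j\<in>UNIV. A $ i $ j * H $ j $ i) = A $ i $ k * H $ k $ i + A $ i $ l * H $ l $ i" for i
    using assms(4) by (intro sum_supported_pair[OF assms(1)]) simp
  then have "trace (A ** H) = (\<Sum>i\<in>UNIV. A $ i $ k * H $ k $ i + A $ i $ l * H $ l $ i)"
    by (simp add: trace_mult_eq)
  also have "\<dots> = A $ k $ k * H $ k $ k + A $ k $ l * H $ l $ k + (A $ l $ k * H $ k $ l + A $ l $ l * H $ l $ l)"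
    by (rule sum_supported_pair[OF assms(1)]) (simp add: H)
  finally show ?thesis
    using sym_mats_comm[OF assms(2), of l k] sym_mats_comm[OF assms(3), of l k] by simp
qed

text \<open>The real parts of \<open>1 - t m\<close> are nonnegative and add up to 0.\<close>

lemma sum_signs_eq_card:
  fixes t :: "'n::finite \<Rightarrow> complex"
  assumes "\<And>m. t m = 1 \<or> t m = -1" "(\<Sum>m\<in>UNIV. t m) = of_nat CARD('n)"
  shows "t m = 1"
proof -
  have "(\<Sum>m\<in>UNIV. 1 - Re (t m)) = 0"
    using arg_cong[OF assms(2), of Re] by (simp add: sum_subtractf)
  moreover have "0 \<le> 1 - Re (t m)" for m
    using assms(1)[of m] by auto
  ultimately have "1 - Re (t m) = 0"
    by (simp add: sum_nonneg_eq_0_iff)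
  then show ?thesis
    using assms(1)[of m] by auto
qed

context trace_quotient_preserver
begin

text \<open>If \<open>\<phi>\<close> fixes \<open>I\<close> and every diagonal matrix unit, then the images of the
  averaging projections onto \<open>{k, l}\<close> force \<open>\<phi>\<close> to multiply the \<open>(k, l)\<close> entry by a sign,
  and the image of the averaging projection onto all coordinates makes the signs multiplicative.\<close>

lemma fixing_diagonal_units:
  assumes fix1: "\<phi> (mat 1) = mat 1" and fixdiag: "\<And>i. \<phi> (averaging {i}) = averaging {i}"
  obtains d :: "'n \<Rightarrow> complex"
  where "\<And>i. d i * d i = 1" "\<And>A k l. A \<in> sym_mats \<Longrightarrow> \<phi> A $ k $ l = d k * A $ k $ l * d l"
proof -
  have idem: "\<phi> X ** \<phi> X = \<phi> X" "A \<in> sym_mats \<Longrightarrow> trace (\<phi> A ** \<phi> X) = trace (A ** X)"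
    if "X \<in> sym_mats" "X ** X = X" for X A
    using idempotent[OF that] by (simp_all add: fix1)
  have diag: "\<phi> A $ k $ k = A $ k $ k" if "A \<in> sym_mats" for A k
    using idem(2)[OF averaging_sym averaging_idempotent that, of "{k}"]
    by (simp add: fixdiag trace_averaging_singleton)
  \<comment> \<open>The off-diagonal entry of the averaging projection onto a pair is 1/2, hence the
    factor 2.\<close>
  define e where "e k l = (if k = l then 1 else 2 * \<phi> (averaging {k, l}) $ k $ l)" for k l
  have e: "(e k l = 1 \<or> e k l = -1) \<and> (\<forall>A\<in>sym_mats. \<phi> A $ k $ l = e k l * A $ k $ l)" for k l
  proof (cases "k = l")
    case False
    define H where "H = \<phi> (averaging {k, l})"
    have H: "H \<in> sym_mats"
      by (simp add: H_def maps)
    \<comment> \<open>The diagonal unit at \<open>m\<close> is orthogonal to the projection onto the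
      pair, and this survives under \<phi>.\<close>
    have supp: "H $ m $ b = 0" if "m \<noteq> k" "m \<noteq> l" for m b
    proof -
      have "\<phi> (averaging {m}) ** K ** \<phi> (averaging {k, l}) = 0"
        using that by (intro orthogonal_idempotents) (simp_all add: averaging_disjoint)
      then have "averaging {m} ** H = 0"
        by (simp add: fix1 fixdiag H_def)
      then show ?thesis
        using averaging_singleton_mult_nth[of m H b] by simp
    qed
    have Hd: "H $ k $ k = 1 / 2" "H $ l $ l = 1 / 2"
      using False by (simp_all add: H_def diag averaging_nth)
    \<comment> \<open>With both diagonal entries equal to 1/2, the \<open>(k, k)\<close> entry of
      this identity says that \<open>2 * H $ k $ l\<close> squares to 1.\<close>
    have "H ** H = H"
      by (simp add: H_def idem)
    from arg_cong[OF this, of "\<lambda>M. M $ k $ k"]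
    have "H $ k $ k = (\<Sum>m\<in>UNIV. H $ k $ m * H $ m $ k)"
      by (simp add: matrix_matrix_mult_def)
    also have "\<dots> = H $ k $ k * H $ k $ k + H $ k $ l * H $ l $ k"
      using supp by (intro sum_supported_pair[OF False]) simp
    also have "H $ l $ k = H $ k $ l"
      by (rule sym_mats_comm[OF H])
    finally have eq: "1 / 2 = 1 / 2 * (1 / 2) + H $ k $ l * H $ k $ l"
      unfolding Hd .
    have "(2 * H $ k $ l) * (2 * H $ k $ l) = 4 * ((1 / 2 * (1 / 2) + H $ k $ l * H $ k $ l) - 1 / 4)"
      by (simp add: algebra_simps)
    then have sq: "(2 * H $ k $ l) * (2 * H $ k $ l) = 1"
      unfolding eq[symmetric] by simp
    \<comment> \<open>In the pairing with \<open>H\<close> the diagonal contributions cancel by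
      \<open>diag\<close>, which isolates the \<open>(k, l)\<close> entry.\<close>
    have "\<phi> A $ k $ l = (2 * H $ k $ l) * A $ k $ l" if A: "A \<in> sym_mats" for A
    proof -
      have "trace (\<phi> A ** H) = \<phi> A $ k $ k * (1/2) + \<phi> A $ l $ l * (1/2) + 2 * (\<phi> A $ k $ l * H $ k $ l)"
        using trace_mult_supported_pair[OF False maps[OF A] H supp] by (simp add: Hd)
      moreover have "trace (A ** averaging {k, l}) = A $ k $ k * (1/2) + A $ l $ l * (1/2) + 2 * (A $ k $ l * (1/2))"
        using False trace_mult_supported_pair[OF False A averaging_sym, of "{k, l}"]
        by (simp add: averaging_nth)
      moreover have "trace (\<phi> A ** H) = trace (A ** averaging {k, l})"
        unfolding H_def by (rule idem(2)) (simp_all add: A)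
      ultimately have "2 * (\<phi> A $ k $ l * H $ k $ l) = A $ k $ l"
        by (simp add: diag[OF A])
      then have "(2 * H $ k $ l) * A $ k $ l = \<phi> A $ k $ l * ((2 * H $ k $ l) * (2 * H $ k $ l))"
        by (simp add: algebra_simps)
      then show ?thesis
        unfolding sq by simp
    qed
    moreover have "2 * H $ k $ l = 1 \<or> 2 * H $ k $ l = -1"
      using sq by (simp only: square_eq_1_iff)
    moreover have "e k l = 2 * H $ k $ l"
      using False by (simp add: e_def H_def)
    ultimately show ?thesis
      by simp
  qed (simp add: e_def diag)
  have pm: "e k l = 1 \<or> e k l = -1" for k l
    using e by blast
  define X :: "complex^'n^'n" where "X = averaging UNIV"
  have X: "\<phi> X $ k $ l = e k l / of_nat CARD('n)" for k l
    using e[of k l] by (simp add: X_def averaging_nth)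
  have sym: "e k l = e l k" for k l
    using sym_mats_comm[OF maps, of X k l] by (simp add: X X_def[symmetric])  (simp add: X_def)
  have mult: "e k m * e m l = e k l" for k l m
  proof -
    have "\<phi> X ** \<phi> X = \<phi> X"
      by (simp add: X_def idem)
    from arg_cong[OF this, of "\<lambda>M. M $ k $ l"]
    have "\<phi> X $ k $ l = (\<Sum>m\<in>UNIV. \<phi> X $ k $ m * \<phi> X $ m $ l)"
      by (simp add: matrix_matrix_mult_def)
    also have "\<dots> = (\<Sum>m\<in>UNIV. e k m * e m l) / (of_nat CARD('n) * of_nat CARD('n))"
      by (simp add: X sum_divide_distrib)
    finally have "(\<Sum>m\<in>UNIV. e k m * e m l) = of_nat CARD('n) * e k l"
      unfolding X by (simp add: field_simps)
    \<comment> \<open>Multiplying by \<open>e k l\<close> turns the summands into n signs with sum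
      n, so all of them are 1.\<close>
    then have "(\<Sum>m\<in>UNIV. e k m * e m l * e k l) = of_nat CARD('n) * e k l * e k l"
      by (simp only: flip: sum_distrib_right)
    also have "\<dots> = of_nat CARD('n)"
      using pm[of k l] by (elim disjE) simp_all
    finally have sum: "(\<Sum>m\<in>UNIV. e k m * e m l * e k l) = of_nat CARD('n)" .
    have "e k m * e m l * e k l = 1 \<or> e k m * e m l * e k l = -1" for m
      using pm[of k m] pm[of m l] pm[of k l] by (elim disjE) simp_all
    from sum_signs_eq_card[OF this sum] have "e k m * e m l * e k l = 1" .
    then show ?thesis
      using pm[of k l] by (elim disjE) (simp_all add: minus_equation_iff)
  qed
  \<comment> \<open>By symmetry and multiplicativity \<open>e k l = e k i * e l i\<close>, so any
    one column of the sign matrix serves as \<open>d\<close>.\<close>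
  fix i
  show ?thesis
  proof
    show "e k i * e k i = 1" for k
      using pm[of k i] by (elim disjE) simp_all
    show "\<phi> A $ k $ l = e k i * A $ k $ l * e l i" if "A \<in> sym_mats" for A k l
    proof -
      have "\<phi> A $ k $ l = (e k i * e i l) * A $ k $ l"
        using e[of k l] that by (simp add: mult)
      then show ?thesis
        by (simp add: sym[of i l])
    qed
  qed
qed

end

section \<open>The bilinear form without conjugation, and reduction to the normalised case\<close>

definition dot :: "complex^'n \<Rightarrow> complex^'n \<Rightarrow> complex" where
  "dot x y = (\<Sum>a\<in>UNIV. x $ a * y $ a)"

lemma dot_scale: "dot (c *s x) y = c * dot x y" "dot x (c *s y) = c * dot x y"
  by (simp_all add: dot_def sum_distrib_left mult_ac)

lemma dot_add: "dot (x + y) z = dot x z + dot y z" "dot x (y + z) = dot x y + dot x z"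
  by (simp_all add: dot_def algebra_simps sum.distrib)

lemma dot_zero: "dot x 0 = 0"
  by (simp add: dot_def)

lemma dot_axis: "dot (axis a 1) y = y $ a"
proof -
  have "axis a 1 $ b * y $ b = (if b = a then y $ a else 0)" for b
    by (simp add: axis_def)
  then show ?thesis
    by (simp add: dot_def)
qed

lemma matrix_vector_axis: "((A :: complex^'n^'n) *v axis b 1) $ a = A $ a $ b"
proof -
  have "A $ a $ c * axis b 1 $ c = (if c = b then A $ a $ b else 0)" for c
    by (simp add: axis_def)
  then show ?thesis
    by (simp add: matrix_vector_mult_def)
qed

lemma dot_matrix_vector: "dot (A *v x) y = dot x (transpose A *v y)"
  by (simp add: dot_def matrix_vector_mult_def transpose_def sum_distrib_left sum_distrib_right mult_ac)
    (rule sum.swap)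

lemma transpose_mult_mult_nth:
  fixes M Q :: "complex^'n^'n"
  shows "(transpose Q ** M ** Q) $ i $ j = dot (column i Q) (M *v column j Q)"
  unfolding matrix_mul_assoc[symmetric]
  by (simp add: matrix_matrix_mult_def transpose_def dot_def matrix_vector_mult_def column_def)

text \<open>Polarisation: if all diagonal entries vanish, a nonzero entry \<open>G $ a $ b\<close>
  is seen by the sum of two basis vectors. Since the form has no conjugation, nonzero vectors may be
  isotropic and one must be chosen.\<close>

lemma sym_mats_nonisotropic:
  fixes G :: "complex^'n^'n"
  assumes G: "G \<in> sym_mats" and "G \<noteq> 0"
  obtains x where "dot x (G *v x) \<noteq> 0"
proof (cases "\<exists>a. G $ a $ a \<noteq> 0")
  case True
  then obtain a where "G $ a $ a \<noteq> 0"
    by blast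
  then show ?thesis
    by (intro that[of "axis a 1"]) (simp add: dot_axis matrix_vector_axis)
next
  case False
  obtain a b where ab: "G $ a $ b \<noteq> 0"
    using \<open>G \<noteq> 0\<close> by (auto simp: vec_eq_iff)
  have "dot (axis a 1 + axis b 1) (G *v (axis a 1 + axis b 1)) = 2 * G $ a $ b"
    using False sym_mats_comm[OF G, of b a]
    by (simp add: dot_axis dot_add matrix_vector_axis matrix_vector_right_distrib)
  with ab show ?thesis
    by (intro that[of "axis a 1 + axis b 1"]) simp
qed

context trace_quotient_preserver
begin

text \<open>The congruence conjugates each quotient by \<open>R\<close>, which leaves its trace
  unchanged.\<close>

lemma congruence_preserver:
  assumes R: "invertible R"
  shows "trace_quotient_preserver (\<lambda>A. R ** \<phi> A ** transpose R)"
proof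
  fix A B :: "complex^'n^'n"
  assume A: "A \<in> sym_mats"
  then show "R ** \<phi> A ** transpose R \<in> sym_mats"
    by auto
  have RT: "invertible (transpose R)"
    using matrix_inv_transpose(2)[OF R] .
  show "invertible A \<Longrightarrow> invertible (R ** \<phi> A ** transpose R)"
    using A R RT by (auto intro!: invertible_mult)
  assume B: "B \<in> sym_mats" "invertible B"
  then have inv: "invertible (\<phi> B)"
    by auto
  have "matrix_inv (R ** \<phi> B ** transpose R) = matrix_inv (transpose R) ** (matrix_inv (\<phi> B) ** matrix_inv R)"
    using R RT inv by (simp add: matrix_inv_prod invertible_mult)
  then have "R ** \<phi> A ** transpose R ** matrix_inv (R ** \<phi> B ** transpose R)
      = R ** \<phi> A ** (transpose R ** matrix_inv (transpose R)) ** (matrix_inv (\<phi> B) ** matrix_inv R)"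
    by (simp only: matrix_mul_assoc)
  also have "\<dots> = R ** (\<phi> A ** matrix_inv (\<phi> B)) ** matrix_inv R"
    by (simp add: matrix_inv_mult RT) (simp only: matrix_mul_assoc)
  finally have "trace (R ** \<phi> A ** transpose R ** matrix_inv (R ** \<phi> B ** transpose R))
      = trace (matrix_inv R ** R ** (\<phi> A ** matrix_inv (\<phi> B)))"
    using trace_mult_rotate[of R "\<phi> A ** matrix_inv (\<phi> B)" "matrix_inv R"] by simp
  then show "trace (R ** \<phi> A ** transpose R ** matrix_inv (R ** \<phi> B ** transpose R)) = trace (A ** matrix_inv B)"
    using tr[OF A B] by (simp add: matrix_inv_mult R)
qed

text \<open>The matrices \<open>\<phi> E\<^sub>i\<^sub>i\<close> are orthogonal idempotents for the product \<open>X K Y\<close>, so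
  normalised vectors \<open>f\<^sub>i\<close> in their ranges are orthonormal for the form \<open>x\<^sup>T K y\<close>.\<close>

lemma normalising_congruence:
  obtains Q where "invertible Q" "transpose Q ** K ** Q = mat 1"
    "\<And>i. transpose Q ** (K ** \<phi> (averaging {i}) ** K) ** Q = averaging {i}"
proof -
  define G where "G i = \<phi> (averaging {i})" for i
  have Gsym: "transpose (G i) = G i" for i
    by (rule sym_matsD) (simp add: G_def maps)
  have G: "G i ** K ** G j = (if i = j then G i else 0)" for i j
  proof (cases "i = j")
    case True
    then show ?thesis
      using idempotent(1)[OF averaging_sym averaging_idempotent, of "{i}"] by (simp add: G_def)
  next
    case False
    then show ?thesis
      using orthogonal_idempotents[of "averaging {i}" "averaging {j}"]
      by (simp add: G_def averaging_disjoint)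
  qed
  have "\<exists>x. dot x (G i *v x) \<noteq> 0" for i
  proof -
    \<comment> \<open>The trace identity for idempotents, applied to the diagonal unit paired with
      itself, would otherwise give 1 = 0.\<close>
    have "G i \<noteq> 0"
    proof
      assume "G i = 0"
      then have "trace (averaging {i} ** averaging {i} :: complex^'n^'n) = 0"
        using idempotent(2)[OF averaging_sym averaging_idempotent averaging_sym, of "{i}" "{i}"]
        by (simp add: G_def trace_linear_simps del: averaging_idempotent)
      then show False
        by (simp only: trace_averaging_singleton) (simp add: averaging_nth)
    qed
    moreover have "G i \<in> sym_mats"
      by (simp add: G_def maps)
    ultimately show ?thesis
      by (metis sym_mats_nonisotropic)
  qed
  then obtain x where x: "\<And>i. dot (x i) (G i *v x i) \<noteq> 0"
    by metis
  \<comment> \<open>With \<open>G i ** K ** G i = G i\<close>, the value of the form of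
    \<open>K\<close> at \<open>f i\<close> is \<open>c i * c i * dot (x i) (G i *v x i)\<close>, so
    a complex square root normalises it to 1.\<close>
  define c where "c i = 1 / csqrt (dot (x i) (G i *v x i))" for i
  have c: "c i * c i * dot (x i) (G i *v x i) = 1" for i
    using x[of i] power2_csqrt[of "dot (x i) (G i *v x i)"]
    by (simp add: c_def power2_eq_square)
  define f where "f i = c i *s (G i *v x i)" for i
  define Q :: "complex^'n^'n" where "Q = (\<chi> a i. f i $ a)"
  have col: "column i Q = f i" for i
    by (simp add: Q_def column_def vec_eq_iff)
  have GK: "(G i ** K) *v f j = (if i = j then f j else 0)" for i j
  proof -
    have "(G i ** K) *v f j = c j *s ((G i ** K ** G j) *v x j)"
      by (simp add: f_def vector_scalar_commute matrix_vector_mul_assoc)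
    then show ?thesis
      by (simp add: G f_def)
  qed
  have dotK: "dot (f i) (K *v f j) = (if i = j then 1 else 0)" for i j
  proof -
    have "dot (f i) (K *v f j) = c i * dot (x i) ((G i ** K) *v f j)"
      by (simp add: f_def[of i] dot_scale dot_matrix_vector Gsym matrix_vector_mul_assoc)
    also have "\<dots> = (if i = j then c i * c i * dot (x i) (G i *v x i) else 0)"
      by (simp add: GK) (simp add: f_def dot_scale dot_zero)
    finally show ?thesis
      by (simp add: c)
  qed
  have 1: "transpose Q ** K ** Q = mat 1"
    unfolding vec_eq_iff transpose_mult_mult_nth col dotK by (simp add: mat_def)
  have 2: "transpose Q ** (K ** G i ** K) ** Q = averaging {i}" for i
  proof -
    have "(K ** G i ** K) *v f j = K *v ((G i ** K) *v f j)" for j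
      by (simp only: matrix_vector_mul_assoc matrix_mul_assoc)
    then have "dot (f k) ((K ** G i ** K) *v f j) = (if i = j then dot (f k) (K *v f j) else 0)" for k j
      by (simp add: GK dot_zero)
    then show ?thesis
      by (simp add: vec_eq_iff transpose_mult_mult_nth col dotK averaging_nth)
  qed
  have "invertible Q"
    using 1 by (auto simp: invertible_left_inverse)
  then show ?thesis
    using that[OF _ 1 2[unfolded G_def]] by blast
qed

text \<open>After the congruence by the inverse of \<open>Q\<close> the map fixes the identity and
  the diagonal units, hence is conjugation by a diagonal sign matrix \<open>D\<close>. Undoing the
  congruence gives \<open>P = Q ** D\<close>.\<close>

lemma congruence:
  obtains P where "invertible P" "\<And>A. A \<in> sym_mats \<Longrightarrow> \<phi> A = P ** A ** transpose P"
proof -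
  obtain Q where Q: "invertible Q" "transpose Q ** K ** Q = mat 1"
    "\<And>i. transpose Q ** (K ** \<phi> (averaging {i}) ** K) ** Q = averaging {i}"
    using normalising_congruence by metis
  define R where "R = transpose Q ** K"
  have RQ: "R ** Q = mat 1" "Q ** R = mat 1"
    using Q(2) matrix_left_right_inverse by (auto simp: R_def)
  have RT: "transpose R = K ** Q"
    using sym_matsD[of K] by (simp add: R_def matrix_transpose_mul)
  define \<psi> where "\<psi> A = R ** \<phi> A ** transpose R" for A
  have "invertible R"
    using RQ by (auto simp: invertible_def)
  then interpret psi: trace_quotient_preserver \<psi>
    unfolding \<psi>_def by (rule congruence_preserver)
  have "\<psi> (mat 1) = transpose Q ** (K ** J) ** K ** Q"
    unfolding \<psi>_def RT unfolding R_def by (simp only: matrix_mul_assoc)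
  then have "\<psi> (mat 1) = mat 1"
    by (simp add: Q(2))
  moreover have "\<psi> (averaging {i}) = averaging {i}" for i
    using Q(3)[of i] unfolding \<psi>_def RT unfolding R_def by (simp only: matrix_mul_assoc)
  ultimately obtain d :: "'n \<Rightarrow> complex" where d: "\<And>i. d i * d i = 1"
    "\<And>A k l. A \<in> sym_mats \<Longrightarrow> \<psi> A $ k $ l = d k * A $ k $ l * d l"
    using psi.fixing_diagonal_units by metis
  define D :: "complex^'n^'n" where "D = (\<chi> i j. if i = j then d i else 0)"
  have DA: "(D ** A) $ k $ l = d k * A $ k $ l" "(A ** D) $ k $ l = A $ k $ l * d l" for A k l
    by (simp_all add: D_def matrix_matrix_mult_def if_distrib[of "\<lambda>x. x * _"] if_distrib[of "\<lambda>x. _ * x"]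
        cong: if_cong)
  have "D ** D = mat 1"
    by (simp add: vec_eq_iff DA) (simp add: D_def d mat_def)
  then have "invertible D"
    by (auto simp: invertible_def)
  have "transpose D = D"
    by (auto simp: D_def transpose_def vec_eq_iff)
  show ?thesis
  proof
    show "invertible (Q ** D)"
      by (intro invertible_mult Q \<open>invertible D\<close>)
    fix A :: "complex^'n^'n"
    assume A: "A \<in> sym_mats"
    have "transpose R ** transpose Q = mat 1"
      using RQ(2) by (simp flip: matrix_transpose_mul)
    then have "\<phi> A = (Q ** R) ** \<phi> A ** (transpose R ** transpose Q)"
      by (simp add: RQ)
    also have "\<dots> = Q ** \<psi> A ** transpose Q"
      unfolding \<psi>_def by (simp only: matrix_mul_assoc)
    also have "\<psi> A = D ** A ** D"
      by (simp add: vec_eq_iff DA d(2)[OF A])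
    finally show "\<phi> A = (Q ** D) ** A ** transpose (Q ** D)"
      by (simp only: matrix_mul_assoc matrix_transpose_mul \<open>transpose D = D\<close>)
  qed
qed

end

subsection \<open>Determinants along lines\<close>

text \<open>Lagrange interpolation expresses the linear coefficient by the values at the nodes in \<open>U\<close>.\<close>

lemma linear_coeff_from_values:
  fixes U :: "complex set"
  assumes U: "finite U" "card U = Suc n"
  obtains w where "\<And>p. degree p \<le> n \<Longrightarrow> coeff p 1 = (\<Sum>u\<in>U. w u * poly p u)"
proof -
  \<comment> \<open>The Lagrange basis polynomials of the nodes in \<open>U\<close>.\<close>
  define L where "L u = (\<Prod>v\<in>U - {u}. smult (1 / (u - v)) [:- v, 1:])" for u
  have L: "poly (L u) v = (if u = v then 1 else 0)" if "u \<in> U" "v \<in> U" for u v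
  proof (cases "u = v")
    case True
    have "poly (smult (1 / (u - x)) [:- x, 1:]) u = 1" if "x \<in> U - {u}" for x
      using that by (auto simp: diff_divide_distrib[symmetric])
    then show ?thesis
      using True by (simp add: L_def poly_prod del: poly_smult poly_pCons)
  next
    case False
    then have "(\<Prod>x\<in>U - {u}. poly (smult (1 / (u - x)) [:- x, 1:]) v) = 0"
      using U that by (intro prod_zero) auto
    then show ?thesis
      using False by (simp add: L_def poly_prod)
  qed
  have deg: "degree (L u) \<le> n" if "u \<in> U" for u
  proof -
    have "degree (L u) \<le> (\<Sum>v\<in>U - {u}. degree (smult (1 / (u - v)) [:- v, 1:]))"
      unfolding L_def
      using degree_prod_sum_le[of "U - {u}" "\<lambda>v. smult (1 / (u - v)) [:- v, 1:]"] U
      by (simp only: o_def finite_Diff)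
    also have "\<dots> \<le> (\<Sum>v\<in>U - {u}. 1)"
      by (intro sum_mono order_trans[OF degree_smult_le]) simp
    finally show ?thesis
      using U that by simp
  qed
  have "coeff p 1 = (\<Sum>u\<in>U. coeff (L u) 1 * poly p u)" if p: "degree p \<le> n" for p
  proof -
    have "p = (\<Sum>u\<in>U. smult (poly p u) (L u))"
    proof (rule poly_eqI_degree)
      fix v assume v: "v \<in> U"
      have "(\<Sum>u\<in>U. poly p u * poly (L u) v) = (\<Sum>u\<in>U. if u = v then poly p v else 0)"
        using v by (intro sum.cong) (simp_all add: L)
      then show "poly p v = poly (\<Sum>u\<in>U. smult (poly p u) (L u)) v"
        using U v by (simp add: poly_sum)
    next
      have "degree (\<Sum>u\<in>U. smult (poly p u) (L u)) \<le> n"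
        using U deg by (intro degree_sum_le) (auto intro: order_trans[OF degree_smult_le])
      then show "degree (\<Sum>u\<in>U. smult (poly p u) (L u)) < card U"
        using U by simp
    qed (use U p in simp)
    then have "coeff p 1 = coeff (\<Sum>u\<in>U. smult (poly p u) (L u)) 1"
      by simp
    then show ?thesis
      by (simp add: coeff_sum mult.commute)
  qed
  then show ?thesis
    by (rule that)
qed

text \<open>The determinant is formed over the polynomial ring from entries of degree at most 1, so
  each Leibniz term has degree at most n.\<close>

lemma det_pencil_poly:
  fixes A B :: "complex^'n^'n"
  obtains q where "degree q \<le> CARD('n)" "\<And>u. poly q (of_real u) = det (u *\<^sub>R A + B)"
proof -
  define M where "M = (\<chi> i j. [:B $ i $ j, A $ i $ j:])"
  have "poly (det M) (of_real u) = det (u *\<^sub>R A + B)" for u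
  proof -
    have "poly (of_int k) x = of_int k" for k and x :: complex
      by (simp add: of_int_poly)
    moreover have "(u *\<^sub>R A + B) $ i $ j = B $ i $ j + of_real u * A $ i $ j" for i j
      by (simp add: scaleR_conv_of_real[of u "A $ i $ j"])
    ultimately show ?thesis
      unfolding det_def by (simp add: poly_sum poly_prod M_def del: vector_add_component)
  qed
  moreover have "degree (det M) \<le> CARD('n)"
    unfolding det_def
  proof (intro degree_sum_le)
    fix p :: "'n \<Rightarrow> 'n"
    have "degree (\<Prod>i\<in>UNIV. M $ i $ p i) \<le> (\<Sum>i\<in>UNIV. degree (M $ i $ p i))"
      using degree_prod_sum_le[of UNIV "\<lambda>i. M $ i $ p i"] by (simp add: o_def)
    also have "\<dots> \<le> (\<Sum>i\<in>(UNIV :: 'n set). 1)"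
      by (intro sum_mono) (simp add: M_def)
    finally have "degree (\<Prod>i\<in>UNIV. M $ i $ p i) \<le> CARD('n)"
      by simp
    moreover have "degree (of_int (sign p) :: complex poly) = 0"
      by (simp add: of_int_poly)
    ultimately show "degree (of_int (sign p) * (\<Prod>i\<in>UNIV. M $ i $ p i)) \<le> CARD('n)"
      using degree_mult_le[of "of_int (sign p)" "\<Prod>i\<in>UNIV. M $ i $ p i"] by simp
  qed simp
  ultimately show ?thesis
    by (intro that[of "det M"])
qed

text \<open>By Jacobi's formula the left side is the linear coefficient of
  \<open>det (u *\<^sub>R X + D)\<close> in \<open>u\<close>. Nodes and weights depend on neither
  \<open>X\<close> nor \<open>D\<close>, so identities between determinants become identities
  between traces.\<close>

lemma trace_from_det_values:
  "\<exists>(U :: real set) w. finite U \<and> 0 \<notin> U \<and> (\<forall>X D :: complex^'n^'n. invertible D \<longrightarrow>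
    det D * trace (X ** matrix_inv D) = (\<Sum>u\<in>U. w u * det (u *\<^sub>R X + D)))"
proof -
  \<comment> \<open>Degree n calls for n + 1 nodes; they avoid 0 so that one can divide by
    \<open>u\<close> later.\<close>
  define U :: "real set" where "U = real ` {1..Suc CARD('n)}"
  have U: "finite U" "0 \<notin> U" "card U = Suc CARD('n)"
    by (auto simp: U_def card_image inj_on_def)
  obtain w where w: "\<And>p. degree p \<le> CARD('n) \<Longrightarrow>
      coeff p 1 = (\<Sum>u\<in>complex_of_real ` U. w u * poly p u)"
    using linear_coeff_from_values[of "complex_of_real ` U" "CARD('n)"] U
    by (auto simp: card_image inj_on_def)
  have "det D * trace (X ** matrix_inv D) = (\<Sum>u\<in>U. w (of_real u) * det (u *\<^sub>R X + D))"
    if D: "invertible D" for X D :: "complex^'n^'n"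
  proof -
    obtain q where q: "degree q \<le> CARD('n)" "\<And>u. poly q (of_real u) = det (u *\<^sub>R X + D)"
      using det_pencil_poly[of X D] by metis
    have "(poly q has_field_derivative poly (pderiv q) (of_real 0)) (at (of_real 0))"
      by (rule poly_DERIV)
    from has_vector_derivative_real_field[OF this, of UNIV]
    have "((\<lambda>u. det (u *\<^sub>R X + D)) has_vector_derivative coeff q 1) (at 0)"
      by (simp add: q poly_0_coeff_0 coeff_pderiv)
    with has_vector_derivative_det_pencil[OF D, of X UNIV]
    have "det D * trace (X ** matrix_inv D) = coeff q 1"
      by (intro vector_derivative_unique_at) simp_all
    also have "\<dots> = (\<Sum>u\<in>U. w (of_real u) * poly q (of_real u))"
      unfolding w[OF q(1)] by (subst sum.reindex) (simp_all add: inj_on_def)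
    finally show ?thesis
      by (simp add: q)
  qed
  then show ?thesis
    using U by (intro exI[of _ U] exI[of _ "\<lambda>u. w (of_real u)"]) blast
qed

lemma det_scaled_sum:
  fixes X Y :: "complex^'n^'n"
  assumes "u \<noteq> 0"
  shows "det (u *\<^sub>R X + Y) = of_real u ^ CARD('n) * det (X + (1 / u) *\<^sub>R Y)"
proof -
  have "u *\<^sub>R X + Y = u *\<^sub>R (X + (1 / u) *\<^sub>R Y)"
    using assms by (simp add: scaleR_add_right)
  then show ?thesis
    by (simp only: det_scaleR)
qed

lemma invertible_scaleR_iff:
  fixes X :: "complex^'n^'n"
  assumes "u \<noteq> 0"
  shows "invertible (u *\<^sub>R X) \<longleftrightarrow> invertible X"
  using assms by (simp add: invertible_det_nz det_scaleR)

text \<open>Factoring out \<open>u\<close> turns the hypothesis into equality of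
  \<open>det (u *\<^sub>R X + D)\<close> and \<open>det (u *\<^sub>R Y + D)\<close> at all nodes.
  Hence \<open>X\<close> and \<open>Y\<close> have the same traces against invertible
  matrices.\<close>

lemma sym_mats_eqI_det:
  fixes X Y :: "complex^'n^'n"
  assumes X: "X \<in> sym_mats" and Y: "Y \<in> sym_mats"
    and eq: "\<And>Z. Z \<in> sym_mats \<Longrightarrow> invertible Z \<Longrightarrow> det (X + Z) = det (Y + Z)"
  shows "X = Y"
proof -
  obtain U :: "real set" and w :: "real \<Rightarrow> complex" where U: "finite U" "0 \<notin> U"
    and w: "\<And>X D :: complex^'n^'n. invertible D \<Longrightarrow>
      det D * trace (X ** matrix_inv D) = (\<Sum>u\<in>U. w u * det (u *\<^sub>R X + D))"
    using trace_from_det_values[where 'n = 'n] by blast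
  have "X - Y = 0"
  proof (rule invertible_trace_nondegenerate)
    fix C :: "complex^'n^'n"
    assume C: "C \<in> sym_mats" "invertible C"
    define D where "D = matrix_inv C"
    have D: "D \<in> sym_mats" "invertible D" "matrix_inv D = C"
      using C by (simp_all add: D_def sym_mats_inv invertible_matrix_inv)
    have "det (u *\<^sub>R X + D) = det (u *\<^sub>R Y + D)" if "u \<in> U" for u
    proof -
      have "u \<noteq> 0"
        using that U(2) by auto
      moreover have "det (X + (1 / u) *\<^sub>R D) = det (Y + (1 / u) *\<^sub>R D)"
        using D \<open>u \<noteq> 0\<close> by (intro eq) (simp_all add: invertible_scaleR_iff)
      ultimately show ?thesis
        by (simp add: det_scaled_sum)
    qed
    then have "det D * trace (X ** C) = det D * trace (Y ** C)"
      using w[OF D(2), of X] w[OF D(2), of Y] D(3) by simp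
    moreover have "det D \<noteq> 0"
      using D(2) by (simp add: invertible_det_nz)
    ultimately show "trace ((X - Y) ** C) = 0"
      by (simp add: matrix_mul_linear_simps trace_linear_simps)
  qed (use X Y in simp)
  then show ?thesis
    by simp
qed

lemma matrix_inv_scaleR:
  fixes X :: "complex^'n^'n"
  assumes "c \<noteq> 0" "invertible X"
  shows "matrix_inv (c *\<^sub>R X) = (1 / c) *\<^sub>R matrix_inv X"
  by (rule matrix_inv_unique) (use assms in \<open>simp add: matrix_mul_linear_simps matrix_inv_mult\<close>)

text \<open>Both sides are differentiated from the right at \<open>s = 0\<close>; the value at
  \<open>s = 0\<close> gives the factor \<open>det (\<phi> B)\<close> that cancels.\<close>

lemma trace_quotient_preserverI_det:
  fixes \<phi> :: "complex^'n^'n \<Rightarrow> complex^'n^'n"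
  assumes maps: "\<And>A. A \<in> sym_mats \<Longrightarrow> \<phi> A \<in> sym_mats" and "\<kappa> \<noteq> 0"
    and det: "\<And>A B s. A \<in> sym_mats \<Longrightarrow> B \<in> sym_mats \<Longrightarrow> s \<ge> 0 \<Longrightarrow>
      det (s *\<^sub>R \<phi> A + \<phi> B) = \<kappa> * det (s *\<^sub>R A + B)"
  shows "trace_quotient_preserver \<phi>"
proof
  fix A B :: "complex^'n^'n"
  assume A: "A \<in> sym_mats"
  show "\<phi> A \<in> sym_mats"
    by (rule maps[OF A])
  have det0: "det (\<phi> B) = \<kappa> * det B" if "B \<in> sym_mats" for B
    using det[OF that that, of 0] by simp
  have inv: "invertible (\<phi> B)" if "B \<in> sym_mats" "invertible B" for B
    using that det0 \<open>\<kappa> \<noteq> 0\<close> by (simp add: invertible_det_nz)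
  then show "invertible A \<Longrightarrow> invertible (\<phi> A)"
    using A .
  assume B: "B \<in> sym_mats" "invertible B"
  have "((\<lambda>s. \<kappa> * det (s *\<^sub>R A + B)) has_vector_derivative \<kappa> * (det B * trace (A ** matrix_inv B)))
      (at 0 within {0..})"
    by (rule bounded_linear.has_vector_derivative[OF bounded_linear_mult_right
        has_vector_derivative_det_pencil[OF B(2)]])
  then have "((\<lambda>s. det (s *\<^sub>R \<phi> A + \<phi> B)) has_vector_derivative \<kappa> * (det B * trace (A ** matrix_inv B)))
      (at 0 within {0..})"
    by (rule has_vector_derivative_transform[rotated 2]) (simp_all add: det A B)
  moreover have "((\<lambda>s. det (s *\<^sub>R \<phi> A + \<phi> B)) has_vector_derivative
      det (\<phi> B) * trace (\<phi> A ** matrix_inv (\<phi> B))) (at 0 within {0..})"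
    by (rule has_vector_derivative_det_pencil[OF inv[OF B]])
  moreover have "at (0::real) within {0..} \<noteq> bot"
    by (simp add: at_within_Ici_at_right)
  ultimately have "det (\<phi> B) * trace (\<phi> A ** matrix_inv (\<phi> B)) = \<kappa> * (det B * trace (A ** matrix_inv B))"
    by (metis vector_derivative_unique_within)
  moreover have "det B \<noteq> 0"
    using B(2) by (simp add: invertible_det_nz)
  ultimately show "trace (\<phi> A ** matrix_inv (\<phi> B)) = trace (A ** matrix_inv B)"
    using \<open>\<kappa> \<noteq> 0\<close> by (simp add: det0[OF B(1)])
qed

subsection \<open>Surjective maps and a single convex combination\<close>

lemma has_vector_derivative_slope_limit:
  fixes f :: "real \<Rightarrow> complex"
  assumes "(f has_vector_derivative d) (at 0)" "f 0 = 0"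
  shows "((\<lambda>s. (1 / s) *\<^sub>R f s) \<longlongrightarrow> d) (at_right 0)"
proof -
  have "(f has_derivative (\<lambda>s. s *\<^sub>R d)) (at_right 0)"
    using assms(1) has_vector_derivative_at_within unfolding has_vector_derivative_def by blast
  then have "((\<lambda>s. (1 / norm (s - 0)) *\<^sub>R (f s - (f 0 + (s - 0) *\<^sub>R d))) \<longlongrightarrow> 0) (at_right 0)"
    unfolding has_derivative_within by blast
  then have "((\<lambda>s. (1 / norm (s - 0)) *\<^sub>R (f s - (f 0 + (s - 0) *\<^sub>R d)) + d) \<longlongrightarrow> 0 + d) (at_right 0)"
    by (intro tendsto_add tendsto_const)
  moreover have "\<forall>\<^sub>F s in at_right 0. (1 / norm (s - 0)) *\<^sub>R (f s - (f 0 + (s - 0) *\<^sub>R d)) + d = (1 / s) *\<^sub>R f s"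
    using eventually_at_right_less[of "0 :: real"]
    by eventually_elim (simp add: assms(2) scaleR_diff_right)
  ultimately show ?thesis
    by (simp add: filterlim_cong)
qed

text \<open>The convex combination divided by \<open>t\<close>: \<open>c\<close> is
  \<open>(1 - t) / t\<close>, positive for \<open>t\<close> strictly between 0 and 1, and \<kappa>
  stands for the n-th power of \<alpha>.\<close>

locale det_combination_surjection =
  fixes \<phi> :: "complex^'n^'n \<Rightarrow> complex^'n^'n" and \<kappa> :: complex and c :: real
  assumes surj: "\<phi> ` sym_mats = sym_mats" and \<kappa>: "\<kappa> \<noteq> 0" and c: "c > 0"
    and det_comb: "A \<in> sym_mats \<Longrightarrow> B \<in> sym_mats \<Longrightarrow> det (\<phi> A + c *\<^sub>R \<phi> B) = \<kappa> * det (A + c *\<^sub>R B)"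
begin

lemma maps [simp, intro]: "A \<in> sym_mats \<Longrightarrow> \<phi> A \<in> sym_mats"
  using surj by blast

lemma preimage:
  assumes "Y \<in> sym_mats"
  obtains B where "B \<in> sym_mats" "\<phi> B = Y"
  using assms surj by (metis imageE)

lemma det_image:
  assumes "A \<in> sym_mats"
  shows "det (\<phi> A) = \<kappa> * det A"
proof -
  have "det ((1 + c) *\<^sub>R \<phi> A) = \<kappa> * det ((1 + c) *\<^sub>R A)"
    using det_comb[OF assms assms] by (simp add: scaleR_add_left)
  then have "of_real (1 + c) ^ CARD('n) * det (\<phi> A) = of_real (1 + c) ^ CARD('n) * (\<kappa> * det A)"
    unfolding det_scaleR by (simp only: mult.left_commute)
  moreover have "complex_of_real (1 + c) \<noteq> 0"
    using c by (simp only: of_real_eq_0_iff)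
  ultimately show ?thesis
    by simp
qed

lemma invertible_image:
  assumes "A \<in> sym_mats"
  shows "invertible (\<phi> A) \<longleftrightarrow> invertible A"
  using det_image[OF assms] \<kappa> by (simp add: invertible_det_nz)

text \<open>Taking \<open>B = 0\<close> shows that adding \<open>c *\<^sub>R \<phi> 0\<close>
  changes the determinant of no value of \<phi>, and by surjectivity every symmetric matrix is such
  a value.\<close>

lemma zero: "\<phi> 0 = 0"
proof -
  have "c *\<^sub>R \<phi> 0 = 0"
  proof (rule sym_mats_eqI_det)
    fix Z :: "complex^'n^'n"
    assume "Z \<in> sym_mats"
    then obtain A where A: "A \<in> sym_mats" "\<phi> A = Z"
      by (rule preimage)
    show "det (c *\<^sub>R \<phi> 0 + Z) = det (0 + Z)"
      using det_comb[OF A(1), of 0] det_image[OF A(1)] by (simp add: A(2) add.commute)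
  qed auto
  then show ?thesis
    using c by simp
qed

text \<open>By surjectivity the test matrices \<open>D / u\<close> are of the form \<open>c \<phi> B\<close>, with \<open>B\<close>
  independent of \<open>A\<close>, so the determinant identity turns entries of \<open>\<phi> (s A)\<close> into
  combinations of the functions \<open>det (s A + c B)\<close>.\<close>

lemma trace_along_ray_differentiable:
  assumes A: "A \<in> sym_mats" and C: "C \<in> sym_mats"
  shows "\<exists>d. ((\<lambda>s. trace (\<phi> (s *\<^sub>R A) ** C)) has_vector_derivative d) (at 0)"
proof -
  let ?T = "{C. \<exists>d. ((\<lambda>s. trace (\<phi> (s *\<^sub>R A) ** C)) has_vector_derivative d) (at 0)}"
  have "subspace ?T"
    unfolding subspace_def
  proof (intro conjI ballI allI)
    show "0 \<in> ?T"
      by (auto simp: trace_linear_simps intro: has_vector_derivative_const)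
    show "x + y \<in> ?T" if "x \<in> ?T" "y \<in> ?T" for x y
      using that by (auto simp: matrix_mul_linear_simps trace_linear_simps intro: has_vector_derivative_add)
    show "r *\<^sub>R x \<in> ?T" if "x \<in> ?T" for r x
      using that by (auto simp: matrix_mul_linear_simps trace_linear_simps
          intro: bounded_linear.has_vector_derivative[OF bounded_linear_scaleR_right])
  qed
  moreover have "C \<in> ?T" if C: "C \<in> sym_mats" "invertible C" for C
  proof -
    obtain U :: "real set" and w :: "real \<Rightarrow> complex" where U: "finite U" "0 \<notin> U"
      and w: "\<And>X D :: complex^'n^'n. invertible D \<Longrightarrow>
        det D * trace (X ** matrix_inv D) = (\<Sum>u\<in>U. w u * det (u *\<^sub>R X + D))"
      using trace_from_det_values[where 'n = 'n] by blast
    define D where "D = matrix_inv C"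
    have D: "D \<in> sym_mats" "invertible D" "matrix_inv D = C" "det D \<noteq> 0"
      using C invertible_matrix_inv[OF C(2)] by (simp_all add: D_def sym_mats_inv flip: invertible_det_nz)
    have "\<exists>B\<in>sym_mats. \<phi> B = (1 / (c * u)) *\<^sub>R D" for u
      using preimage[of "(1 / (c * u)) *\<^sub>R D"] D(1) by blast
    then obtain b where b: "\<And>u. b u \<in> sym_mats" "\<And>u. \<phi> (b u) = (1 / (c * u)) *\<^sub>R D"
      by metis
    have "trace (\<phi> (s *\<^sub>R A) ** C) =
        (1 / det D) * (\<Sum>u\<in>U. (w u * of_real u ^ CARD('n) * \<kappa>) * det (s *\<^sub>R A + c *\<^sub>R b u))" for s
    proof -
      have "det (u *\<^sub>R \<phi> (s *\<^sub>R A) + D) = of_real u ^ CARD('n) * \<kappa> * det (s *\<^sub>R A + c *\<^sub>R b u)"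
        if "u \<in> U" for u
      proof -
        have "u \<noteq> 0"
          using that U(2) by auto
        then show ?thesis
          using det_comb[of "s *\<^sub>R A" "b u"] A b c by (simp add: det_scaled_sum)
      qed
      then have "det D * trace (\<phi> (s *\<^sub>R A) ** C) =
          (\<Sum>u\<in>U. (w u * of_real u ^ CARD('n) * \<kappa>) * det (s *\<^sub>R A + c *\<^sub>R b u))"
        using w[OF D(2), of "\<phi> (s *\<^sub>R A)"] D(3) by (simp add: mult.assoc)
      then show ?thesis
        using D(4) by (simp add: field_simps)
    qed
    moreover have "\<exists>d. ((\<lambda>s. det (s *\<^sub>R A + c *\<^sub>R b u)) has_vector_derivative d) (at 0)" for u
      using has_vector_derivative_det[OF pencil_entry_derivative] by blast
    then obtain d where "\<And>u. ((\<lambda>s. det (s *\<^sub>R A + c *\<^sub>R b u)) has_vector_derivative d u) (at 0)"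
      by metis
    then have "((\<lambda>s. (1 / det D) * (\<Sum>u\<in>U. (w u * of_real u ^ CARD('n) * \<kappa>) * det (s *\<^sub>R A + c *\<^sub>R b u)))
        has_vector_derivative (1 / det D) * (\<Sum>u\<in>U. (w u * of_real u ^ CARD('n) * \<kappa>) * d u)) (at 0)"
      by (intro bounded_linear.has_vector_derivative[OF bounded_linear_mult_right] has_vector_derivative_sum)
    ultimately show ?thesis
      by auto
  qed
  ultimately have "span {C \<in> sym_mats. invertible C} \<subseteq> ?T"
    by (intro span_minimal) auto
  then have "C \<in> ?T"
    using subsetD[OF sym_mats_subset_span_invertible C] by (rule subsetD)
  then show ?thesis
    by simp
qed

text \<open>The directional derivative of \<phi> at 0, taken entrywise.
  \<open>entry_derivative\<close> shows that it exists in symmetric directions.\<close>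

definition derivative_at_zero :: "complex^'n^'n \<Rightarrow> complex^'n^'n" where
  "derivative_at_zero A = (\<chi> i j. vector_derivative (\<lambda>s. \<phi> (s *\<^sub>R A) $ i $ j) (at 0))"

lemma entry_derivative:
  assumes A: "A \<in> sym_mats"
  shows "((\<lambda>s. \<phi> (s *\<^sub>R A) $ i $ j) has_vector_derivative derivative_at_zero A $ i $ j) (at 0)"
proof -
  \<comment> \<open>Half the sum of the matrix units at \<open>(i, j)\<close> and
    \<open>(j, i)\<close>: a symmetric matrix whose trace pairing reads off the entry
    \<open>(i, j)\<close>.\<close>
  define C :: "complex^'n^'n" where
    "C = (\<chi> a b. (if a = j then if b = i then 1 / 2 else 0 else 0) + (if a = i then if b = j then 1 / 2 else 0 else 0))"
  have C: "C \<in> sym_mats"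
    by (auto simp: sym_mats_def C_def transpose_def vec_eq_iff)
  have "trace (X ** C) = X $ i $ j" if "X \<in> sym_mats" for X
  proof -
    have "X $ a $ b * C $ b $ a = (if b = j then if a = i then X $ i $ j / 2 else 0 else 0)
        + (if b = i then if a = j then X $ j $ i / 2 else 0 else 0)" for a b
      by (simp add: C_def)
    then have "trace (X ** C) = X $ i $ j / 2 + X $ j $ i / 2"
      by (simp add: trace_mult_eq sum.distrib)
    then show ?thesis
      using sym_mats_comm[OF that, of j i] by simp
  qed
  then have "\<exists>d. ((\<lambda>s. \<phi> (s *\<^sub>R A) $ i $ j) has_vector_derivative d) (at 0)"
    using trace_along_ray_differentiable[OF A C] A by simp
  then show ?thesis
    by (auto simp: derivative_at_zero_def vector_derivative_works[symmetric] intro: differentiableI_vector)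
qed

lemma derivative_at_zero_sym [simp, intro]:
  assumes "A \<in> sym_mats"
  shows "derivative_at_zero A \<in> sym_mats"
proof -
  have "(\<lambda>s. \<phi> (s *\<^sub>R A) $ i $ j) = (\<lambda>s. \<phi> (s *\<^sub>R A) $ j $ i)" for i j
    using assms by (intro ext sym_mats_comm maps sym_mats_closed)
  then show ?thesis
    by (simp add: sym_mats_def transpose_def vec_eq_iff derivative_at_zero_def)
qed

text \<open>Jacobi's formula on both sides of \<open>det_comb\<close> along the ray through
  \<open>A\<close>, at \<open>s = 0\<close>, where \<open>zero\<close> leaves only the invertible
  term in \<open>B\<close>.\<close>

lemma trace_derivative_at_zero:
  assumes A: "A \<in> sym_mats" and B: "B \<in> sym_mats" "invertible B"
  shows "trace (derivative_at_zero A ** matrix_inv (\<phi> B)) = trace (A ** matrix_inv B)"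
proof -
  let ?M = "\<lambda>s. \<phi> (s *\<^sub>R A) + c *\<^sub>R \<phi> B"
  have inv: "invertible (c *\<^sub>R \<phi> B)" "invertible (c *\<^sub>R B)" "invertible (\<phi> B)"
    using B c by (simp_all add: invertible_scaleR_iff invertible_image)
  have "((\<lambda>s. ?M s $ i $ j) has_vector_derivative derivative_at_zero A $ i $ j) (at 0)" for i j
    using has_vector_derivative_add[OF entry_derivative[OF A] has_vector_derivative_const] by simp
  from has_vector_derivative_det_invertible[OF this] inv(1)
  have "((\<lambda>s. det (?M s)) has_vector_derivative
      det (c *\<^sub>R \<phi> B) * trace (derivative_at_zero A ** matrix_inv (c *\<^sub>R \<phi> B))) (at 0)"
    by (simp add: zero)
  moreover have "det (?M s) = \<kappa> * det (s *\<^sub>R A + c *\<^sub>R B)" for s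
    using A B by (intro det_comb) auto
  moreover have "((\<lambda>s. \<kappa> * det (s *\<^sub>R A + c *\<^sub>R B)) has_vector_derivative
      \<kappa> * (det (c *\<^sub>R B) * trace (A ** matrix_inv (c *\<^sub>R B)))) (at 0)"
    by (rule bounded_linear.has_vector_derivative[OF bounded_linear_mult_right
        has_vector_derivative_det_pencil[OF inv(2)]])
  ultimately have "det (c *\<^sub>R \<phi> B) * trace (derivative_at_zero A ** matrix_inv (c *\<^sub>R \<phi> B))
      = \<kappa> * (det (c *\<^sub>R B) * trace (A ** matrix_inv (c *\<^sub>R B)))"
    by (simp add: vector_derivative_unique_at)
  moreover have "det (c *\<^sub>R \<phi> B) = \<kappa> * det (c *\<^sub>R B)"
    by (simp add: det_scaleR det_image[OF B(1)])
  moreover have "det (c *\<^sub>R B) \<noteq> 0"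
    using inv(2) by (simp add: invertible_det_nz)
  ultimately have "trace (derivative_at_zero A ** matrix_inv (c *\<^sub>R \<phi> B)) = trace (A ** matrix_inv (c *\<^sub>R B))"
    using \<kappa> by simp
  then show ?thesis
    using c B(2) inv(3) by (simp add: matrix_inv_scaleR matrix_mul_linear_simps trace_linear_simps)
qed

text \<open>The mixed trace identity provides an adjoint built from \<phi>, so the derivative is
  linear although \<phi> is not yet known to be.\<close>

lemma derivative_at_zero_linear:
  assumes A: "A \<in> sym_mats" and B: "B \<in> sym_mats"
  shows "derivative_at_zero (s *\<^sub>R A + B) = s *\<^sub>R derivative_at_zero A + derivative_at_zero B"
proof -
  let ?g = "\<lambda>C. matrix_inv (\<phi> (matrix_inv C))"
  have g: "?g C \<in> sym_mats" if "C \<in> sym_mats" "invertible C" for C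
    using that by (auto simp: invertible_matrix_inv invertible_image)
  have tr: "trace (derivative_at_zero A ** ?g C) = trace (A ** C)"
    if "A \<in> sym_mats" "C \<in> sym_mats" "invertible C" for A C
    using trace_derivative_at_zero[of A "matrix_inv C"] that by (simp add: invertible_matrix_inv)
  note lin = trace_adjoint_linear[of derivative_at_zero ?g, OF derivative_at_zero_sym g tr]
  show ?thesis
    using lin(1)[of "s *\<^sub>R A" B] lin(2)[of A s] A B by simp
qed

text \<open>The determinant of \<open>(1 / s) *\<^sub>R \<phi> (s *\<^sub>R A)\<close> does not
  depend on \<open>s > 0\<close>, since \<open>det_image\<close> and homogeneity cancel the powers
  of \<open>s\<close>; it therefore equals its limit.\<close>

lemma det_derivative_at_zero:
  assumes A: "A \<in> sym_mats"
  shows "det (derivative_at_zero A) = \<kappa> * det A"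
proof -
  have "((\<lambda>s. (1 / s) *\<^sub>R \<phi> (s *\<^sub>R A)) \<longlongrightarrow> derivative_at_zero A) (at_right 0)"
  proof (intro vec_tendstoI)
    show "((\<lambda>s. ((1 / s) *\<^sub>R \<phi> (s *\<^sub>R A)) $ i $ j) \<longlongrightarrow> derivative_at_zero A $ i $ j) (at_right 0)" for i j
      using has_vector_derivative_slope_limit[OF entry_derivative[OF A]] by (simp add: zero)
  qed
  from tendsto_det[OF this]
  have "((\<lambda>s. det ((1 / s) *\<^sub>R \<phi> (s *\<^sub>R A))) \<longlongrightarrow> det (derivative_at_zero A)) (at_right 0)" .
  moreover have "\<forall>\<^sub>F s in at_right 0. det ((1 / s) *\<^sub>R \<phi> (s *\<^sub>R A)) = \<kappa> * det A"
    using eventually_at_right_less[of "0 :: real"]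
  proof eventually_elim
    case (elim s)
    have "det ((1 / s) *\<^sub>R \<phi> (s *\<^sub>R A)) = of_real (1 / s) ^ CARD('n) * (\<kappa> * (of_real s ^ CARD('n) * det A))"
      using A by (simp only: det_scaleR det_image[OF sym_mats_closed(3)[OF A]])
    also have "\<dots> = (of_real (1 / s) * of_real s) ^ CARD('n) * (\<kappa> * det A)"
      unfolding power_mult_distrib by (simp only: mult_ac)
    also have "complex_of_real (1 / s) * of_real s = 1"
      using elim by (simp flip: of_real_mult)
    finally show ?case
      by simp
  qed
  then have "((\<lambda>s. det ((1 / s) *\<^sub>R \<phi> (s *\<^sub>R A))) \<longlongrightarrow> \<kappa> * det A) (at_right 0)"
    by (rule tendsto_eventually)
  ultimately show ?thesis
    by (rule tendsto_unique[OF trivial_limit_at_right_real])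
qed

text \<open>The derivative at \<open>0\<close> satisfies the trace condition on its own, and comparing it with
  the mixed condition \<open>trace_derivative_at_zero\<close> shows that it agrees with \<open>\<phi>\<close>.\<close>

lemma trace_quotient_preserver: "trace_quotient_preserver \<phi>"
proof -
  let ?\<delta> = derivative_at_zero
  interpret \<delta>: trace_quotient_preserver ?\<delta>
  proof (rule trace_quotient_preserverI_det)
    fix A B :: "complex^'n^'n" and s :: real
    assume "A \<in> sym_mats" "B \<in> sym_mats"
    then show "det (s *\<^sub>R ?\<delta> A + ?\<delta> B) = \<kappa> * det (s *\<^sub>R A + B)"
      by (simp add: det_derivative_at_zero flip: derivative_at_zero_linear)
  qed (use \<kappa> in auto)
  \<comment> \<open>The inverses of \<open>\<phi> B\<close> and of the derivative at
    \<open>B\<close> have the same pairing with all values of the derivative, and these separate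
    symmetric matrices.\<close>
  have inv_eq: "\<phi> B = ?\<delta> B" if B: "B \<in> sym_mats" "invertible B" for B
  proof -
    have "matrix_inv (\<phi> B) - matrix_inv (?\<delta> B) = 0"
    proof (rule \<delta>.nondegenerate)
      show "trace (?\<delta> A ** (matrix_inv (\<phi> B) - matrix_inv (?\<delta> B))) = 0" if "A \<in> sym_mats" for A
        using that B by (simp add: matrix_mul_linear_simps trace_linear_simps trace_derivative_at_zero \<delta>.tr)
    qed (use B in \<open>auto simp: invertible_image\<close>)
    then have "matrix_inv (matrix_inv (\<phi> B)) = matrix_inv (matrix_inv (?\<delta> B))"
      by simp
    then show ?thesis
      using B by (simp add: invertible_matrix_inv invertible_image)
  qed
  \<comment> \<open>Singular \<open>A\<close> is reached by determinants: each invertible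
    \<open>Z\<close> is \<open>c *\<^sub>R \<phi> B\<close> with \<open>B\<close> invertible, where
    both maps already agree.\<close>
  have eq: "\<phi> A = ?\<delta> A" if A: "A \<in> sym_mats" for A
  proof (rule sym_mats_eqI_det)
    fix Z :: "complex^'n^'n"
    assume Z: "Z \<in> sym_mats" "invertible Z"
    have "(1 / c) *\<^sub>R Z \<in> sym_mats"
      using Z by simp
    then obtain B where B: "B \<in> sym_mats" "\<phi> B = (1 / c) *\<^sub>R Z"
      by (rule preimage)
    have "invertible (\<phi> B)"
      using Z(2) c by (simp add: B(2) invertible_scaleR_iff)
    then have "invertible B"
      by (simp only: invertible_image[OF B(1)])
    then have inv_eq': "?\<delta> B = \<phi> B"
      by (simp add: inv_eq[OF B(1)])
    have ZB: "Z = c *\<^sub>R ?\<delta> B" "Z = c *\<^sub>R \<phi> B"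
      unfolding inv_eq' B(2) using c by simp_all
    have "det (\<phi> A + Z) = det (?\<delta> (c *\<^sub>R B + A))"
      unfolding ZB(2) using A B(1) by (simp add: det_comb det_derivative_at_zero add.commute)
    also have "?\<delta> (c *\<^sub>R B + A) = ?\<delta> A + Z"
      unfolding derivative_at_zero_linear[OF B(1) A] ZB(1) by simp
    finally show "det (\<phi> A + Z) = det (?\<delta> A + Z)" .
  qed (use A in auto)
  show ?thesis
    by unfold_locales (simp_all add: eq \<delta>.tr \<delta>.inv)
qed

end

subsection \<open>The four equivalent conditions\<close>

lemma scale_mat_eq: "scale_mat c A = mat c ** A"
proof -
  have "mat c $ i $ k * A $ k $ j = (if k = i then c * A $ i $ j else 0)" for i j k
    by (simp add: mat_def)
  then show ?thesis
    by (simp add: scale_mat_def matrix_matrix_mult_def vec_eq_iff)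
qed

lemma scale_mat_mult: "scale_mat c A ** B = scale_mat c (A ** B)" "A ** scale_mat c B = scale_mat c (A ** B)"
  by (simp_all add: scale_mat_def matrix_matrix_mult_def vec_eq_iff sum_distrib_left mult_ac)

lemma scale_mat_scale_mat: "scale_mat a (scale_mat b A) = scale_mat (a * b) A"
  and scale_mat_1: "scale_mat 1 A = A"
  and transpose_scale_mat: "transpose (scale_mat c A) = scale_mat c (transpose A)"
  by (simp_all add: scale_mat_def vec_eq_iff transpose_def mult.assoc)

lemma det_scale_mat: "det (scale_mat c A) = c ^ CARD('n) * det A" for A :: "complex^'n^'n"
  by (simp add: scale_mat_eq det_mul det_diagonal mat_def)

text \<open>A square root \<beta> of \<alpha> is absorbed into the matrix,
  \<open>R = scale_mat \<beta> P\<close>, and removed again by \<open>1 / \<beta>\<close>.\<close>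

lemma scaled_congruence_iff:
  fixes \<phi> :: "complex^'n^'n \<Rightarrow> complex^'n^'n"
  assumes "\<alpha> \<noteq> 0"
  shows "scaled_congruence \<alpha> \<phi> \<longleftrightarrow>
    (\<exists>R. (det R)\<^sup>2 = \<alpha> ^ CARD('n) \<and> (\<forall>A\<in>sym_mats. \<phi> A = R ** A ** transpose R))"
proof
  define \<beta> where "\<beta> = csqrt \<alpha>"
  have \<beta>: "\<beta> * \<beta> = \<alpha>" "\<beta> \<noteq> 0"
    using assms power2_csqrt[of \<alpha>] by (auto simp: \<beta>_def power2_eq_square)
  have \<beta>n: "(\<beta> ^ CARD('n))\<^sup>2 = \<alpha> ^ CARD('n)"
    by (simp add: \<beta>(1)[symmetric] power2_eq_square power_mult_distrib)
  {
    assume "scaled_congruence \<alpha> \<phi>"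
    then obtain P :: "complex^'n^'n" where P: "(det P)\<^sup>2 = 1"
      "\<And>A. A \<in> sym_mats \<Longrightarrow> \<phi> A = scale_mat \<alpha> (P ** A ** transpose P)"
      unfolding scaled_congruence_def by blast
    show "\<exists>R. (det R)\<^sup>2 = \<alpha> ^ CARD('n) \<and> (\<forall>A\<in>sym_mats. \<phi> A = R ** A ** transpose R)"
    proof (intro exI[of _ "scale_mat \<beta> P"] conjI ballI)
      show "(det (scale_mat \<beta> P))\<^sup>2 = \<alpha> ^ CARD('n)"
        by (simp add: det_scale_mat power_mult_distrib P(1) \<beta>n)
      show "\<phi> A = scale_mat \<beta> P ** A ** transpose (scale_mat \<beta> P)" if "A \<in> sym_mats" for A
        using P(2)[OF that] by (simp add: scale_mat_mult transpose_scale_mat scale_mat_scale_mat \<beta>)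
    qed
  next
    assume "\<exists>R. (det R)\<^sup>2 = \<alpha> ^ CARD('n) \<and> (\<forall>A\<in>sym_mats. \<phi> A = R ** A ** transpose R)"
    then obtain R where R: "(det R)\<^sup>2 = \<alpha> ^ CARD('n)"
      "\<And>A. A \<in> sym_mats \<Longrightarrow> \<phi> A = R ** A ** transpose R"
      by blast
    show "scaled_congruence \<alpha> \<phi>"
      unfolding scaled_congruence_def
    proof (intro exI[of _ "scale_mat (1 / \<beta>) R"] conjI ballI)
      show det: "(det (scale_mat (1 / \<beta>) R))\<^sup>2 = 1"
        using assms by (simp add: det_scale_mat power_mult_distrib power_divide R(1) \<beta>n)
      then show "invertible (scale_mat (1 / \<beta>) R)"
        by (auto simp: invertible_det_nz)
      have "\<alpha> * (1 / \<beta> * (1 / \<beta>)) = 1"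
        using \<beta> by (simp flip: \<beta>(1))
      then show "\<phi> A = scale_mat \<alpha> (scale_mat (1 / \<beta>) R ** A ** transpose (scale_mat (1 / \<beta>) R))"
        if "A \<in> sym_mats" for A
        by (simp only: R(2)[OF that] scale_mat_mult transpose_scale_mat scale_mat_scale_mat scale_mat_1)
    qed
  }
qed

lemma trace_quotient_preserver_iff:
  "trace_quotient_preserver \<phi> \<longleftrightarrow> (\<forall>A\<in>sym_mats. \<phi> A \<in> sym_mats) \<and>
    (\<forall>A\<in>sym_mats. invertible A \<longrightarrow> invertible (\<phi> A)) \<and> preserves_trace_quotient \<phi>"
  unfolding trace_quotient_preserver_def preserves_trace_quotient_def by blast

lemma det_combination_at_pos:
  fixes \<phi> :: "complex^'n^'n \<Rightarrow> complex^'n^'n"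
  assumes "det_combination_at \<alpha> \<phi> t" "t > 0" "A \<in> sym_mats" "B \<in> sym_mats"
  shows "det (\<phi> A + ((1 - t) / t) *\<^sub>R \<phi> B) = \<alpha> ^ CARD('n) * det (A + ((1 - t) / t) *\<^sub>R B)"
proof -
  have "det (t *\<^sub>R X + (1 - t) *\<^sub>R Y) = of_real t ^ CARD('n) * det (X + ((1 - t) / t) *\<^sub>R Y)"
    for X Y :: "complex^'n^'n"
    using assms(2) by (simp add: det_scaled_sum)
  then show ?thesis
    using assms by (simp add: det_combination_at_def)
qed

lemma det_combination_at_imp_preserver:
  fixes \<phi> :: "complex^'n^'n \<Rightarrow> complex^'n^'n"
  assumes maps: "\<And>A. A \<in> sym_mats \<Longrightarrow> \<phi> A \<in> sym_mats" and "\<alpha> \<noteq> 0"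
    and comb: "\<And>t. t \<in> {0..1} \<Longrightarrow> det_combination_at \<alpha> \<phi> t"
  shows "trace_quotient_preserver \<phi>"
proof (rule trace_quotient_preserverI_det[OF maps, of _ "\<alpha> ^ CARD('n)"])
  fix A B :: "complex^'n^'n" and s :: real
  assume AB: "A \<in> sym_mats" "B \<in> sym_mats" and s: "s \<ge> 0"
  \<comment> \<open>Every \<open>s \<ge> 0\<close> is the ratio \<open>(1 - t) / t\<close> for
    \<open>t = 1 / (1 + s)\<close>; \<open>A\<close> and \<open>B\<close> exchange roles because
    \<open>s\<close> multiplies \<open>A\<close>.\<close>
  have "(1 - 1 / (1 + s)) / (1 / (1 + s)) = s"
    using s by (simp add: field_simps)
  then show "det (s *\<^sub>R \<phi> A + \<phi> B) = \<alpha> ^ CARD('n) * det (s *\<^sub>R A + B)"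
    using det_combination_at_pos[OF comb _ AB(2,1), of "1 / (1 + s)"] s by (simp add: add.commute)
qed (simp_all add: \<open>\<alpha> \<noteq> 0\<close>)

lemma det_combination_surjection_imp_preserver:
  fixes \<phi> :: "complex^'n^'n \<Rightarrow> complex^'n^'n"
  assumes "\<phi> ` sym_mats = sym_mats" "\<alpha> \<noteq> 0" "det_combination_at \<alpha> \<phi> t" "0 < t" "t < 1"
  shows "trace_quotient_preserver \<phi>"
proof -
  interpret det_combination_surjection \<phi> "\<alpha> ^ CARD('n)" "(1 - t) / t"
    using assms by unfold_locales (auto intro: det_combination_at_pos)
  show ?thesis
    by (rule trace_quotient_preserver)
qed

theorem theorem4p1:
  fixes \<phi> :: "complex^'n^'n \<Rightarrow> complex^'n^'n" and \<alpha> :: complex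
  assumes maps: "\<And>A. A \<in> sym_mats \<Longrightarrow> \<phi> A \<in> sym_mats"
    and alpha: "\<alpha> ^ CARD('n) = det (\<phi> (mat 1))"
    and alpha_nonzero: "\<alpha> \<noteq> 0"
  shows "(scaled_congruence \<alpha> \<phi> \<longleftrightarrow>
            (\<forall>A\<in>sym_mats. invertible A \<longrightarrow> invertible (\<phi> A)) \<and> preserves_trace_quotient \<phi>)
       \<and> (scaled_congruence \<alpha> \<phi> \<longleftrightarrow> (\<forall>t\<in>{0..1}. det_combination_at \<alpha> \<phi> t))
       \<and> (scaled_congruence \<alpha> \<phi> \<longleftrightarrow>
            \<phi> ` sym_mats = sym_mats \<and> det_combination_at_two \<alpha> \<phi>)"
proof -
  have preserver: "trace_quotient_preserver \<phi> \<longleftrightarrow>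
      (\<forall>A\<in>sym_mats. invertible A \<longrightarrow> invertible (\<phi> A)) \<and> preserves_trace_quotient \<phi>"
    using maps by (simp add: trace_quotient_preserver_iff)
  have congruence: "scaled_congruence \<alpha> \<phi>" if "trace_quotient_preserver \<phi>"
  proof -
    interpret trace_quotient_preserver \<phi>
      by (rule that)
    obtain P where P: "\<And>A. A \<in> sym_mats \<Longrightarrow> \<phi> A = P ** A ** transpose P"
      using congruence by metis
    \<comment> \<open>Determinants are compared at the identity, where the value of \<phi> is
      \<open>P ** transpose P\<close>.\<close>
    have "(det P)\<^sup>2 = \<alpha> ^ CARD('n)"
      unfolding alpha by (simp add: P det_mul power2_eq_square)
    with P show ?thesis
      using alpha_nonzero by (auto simp: scaled_congruence_iff)
  qed
  have consequences: "trace_quotient_preserver \<phi> \<and> (\<forall>t. det_combination_at \<alpha> \<phi> t) \<and> \<phi> ` sym_mats = sym_mats"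
    if cong: "scaled_congruence \<alpha> \<phi>"
  proof -
    obtain R where R: "(det R)\<^sup>2 = \<alpha> ^ CARD('n)"
      "\<And>A. A \<in> sym_mats \<Longrightarrow> \<phi> A = R ** A ** transpose R"
      using cong alpha_nonzero by (auto simp: scaled_congruence_iff)
    have "invertible R"
      using R(1) alpha_nonzero by (auto simp: invertible_det_nz)
    have comb: "det_combination_at \<alpha> \<phi> t" for t
      unfolding det_combination_at_def
    proof (intro ballI)
      fix A B :: "complex^'n^'n"
      assume "A \<in> sym_mats" "B \<in> sym_mats"
      then have "t *\<^sub>R \<phi> A + (1 - t) *\<^sub>R \<phi> B = R ** (t *\<^sub>R A + (1 - t) *\<^sub>R B) ** transpose R"
        by (simp add: R(2) matrix_mul_linear_simps)
      then show "det (t *\<^sub>R \<phi> A + (1 - t) *\<^sub>R \<phi> B) = \<alpha> ^ CARD('n) * det (t *\<^sub>R A + (1 - t) *\<^sub>R B)"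
        by (simp add: det_mul power2_eq_square flip: R(1))
    qed
    have surj: "\<phi> ` sym_mats = sym_mats"
    proof
      show "\<phi> ` sym_mats \<subseteq> sym_mats"
        using maps by (rule image_subsetI)
      show "sym_mats \<subseteq> \<phi> ` sym_mats"
      proof
        fix Y :: "complex^'n^'n"
        assume Y: "Y \<in> sym_mats"
        define A where "A = matrix_inv R ** Y ** transpose (matrix_inv R)"
        have "A \<in> sym_mats"
          using Y by (simp add: A_def sym_mats_congruence)
        have "\<phi> A = (R ** matrix_inv R) ** Y ** transpose (R ** matrix_inv R)"
          unfolding R(2)[OF \<open>A \<in> sym_mats\<close>] unfolding A_def matrix_transpose_mul
          by (simp only: matrix_mul_assoc)
        then have "\<phi> A = Y"
          by (simp add: matrix_inv_mult \<open>invertible R\<close>)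
        then show "Y \<in> \<phi> ` sym_mats"
          using \<open>A \<in> sym_mats\<close> by blast
      qed
    qed
    \<comment> \<open>The trace condition follows from the determinant identity just shown, by
      differentiation.\<close>
    have "trace_quotient_preserver \<phi>"
      using maps alpha_nonzero comb by (rule det_combination_at_imp_preserver)
    with comb surj show ?thesis
      by simp
  qed
  have four: "trace_quotient_preserver \<phi>" if surj: "\<phi> ` sym_mats = sym_mats" and two: "det_combination_at_two \<alpha> \<phi>"
  proof -
    obtain t where t: "0 < t" "t < 1" "det_combination_at \<alpha> \<phi> t"
    proof -
      obtain r s where rs: "r \<in> {0..1}" "s \<in> {0..1}" "r \<noteq> s" "{r, s} \<noteq> {0, 1}"
        "det_combination_at \<alpha> \<phi> r" "det_combination_at \<alpha> \<phi> s"
        using two unfolding det_combination_at_two_def by blast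
      \<comment> \<open>Two distinct parameters other than the pair of endpoints include one
        strictly between 0 and 1, and this one suffices.\<close>
      have "0 < r \<and> r < 1 \<or> 0 < s \<and> s < 1"
        using rs(1-4) by (auto simp: less_le)
      then show ?thesis
        using that[of r] that[of s] rs(5,6) by blast
    qed
    show ?thesis
      using surj alpha_nonzero t(3,1,2) by (rule det_combination_surjection_imp_preserver)
  qed
  have two: "det_combination_at_two \<alpha> \<phi>" if "\<forall>t. det_combination_at \<alpha> \<phi> t"
    unfolding det_combination_at_two_def
    by (intro bexI[of _ "1/2"] bexI[of _ "1/3"]) (simp_all add: that doubleton_eq_iff)
  have three: "trace_quotient_preserver \<phi>" if "\<forall>t\<in>{0..1}. det_combination_at \<alpha> \<phi> t"
    using maps alpha_nonzero bspec[OF that] by (rule det_combination_at_imp_preserver)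
  show ?thesis
    unfolding preserver[symmetric]
    using congruence consequences two three four by meson
qed

end
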